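(* Let $q$ be a prime power, and let $\mathcal C_X$ and $\mathcal C_Z$ be $[n,k_X,d_X]_q$ and $[n,k_Z,d_Z]_q$ linear codes, respectively, where $d_X,d_Z\ge2$. Let $r$ denote the minimum locality of the CSS-like EAQLRC $\mathcal Q(\mathcal C_X,\mathcal C_Z)$, i.e. the smallest integer $r$ such that $\mathcal Q(\mathcal C_X,\mathcal C_Z)$ has locality $r$. Then $$r\le\min\{n-1,\ k_X+k_Z-\dim(\mathcal C_X\cap\mathcal C_Z)\}.$$
   Context: Notation. $[m]=\{1,\dots,m\}$. An $[n,k,d]_q$ linear code is a $k$-dimensional subspace of $\mathbb F_q^n$ with minimum distance $d$; $\mathcal C^\perp$ is the Euclidean dual; a parity-check matrix of an $[n,k]_q$ code $\mathcal C$ is an $(n-k)\times n$ matrix $\mathbf H$ with $\mathcal C=\ker\mathbf H$ and $\mathcal C^\perp$ equal to the row space of $\mathbf H$. $\mathrm{supp}(\mathbf u)=\{i:u_i\neq0\}$. Registers and Paulis. A qudit has Hilbert space $\mathbb C^q$ with basis $\{|x\rangle:x\in\mathbb F_q\}$, $q=p^m$. $Q=Q_{[n]}=(Q_1,\dots,Q_n)$ is the transmitted register, $B=B_{[c]}$ is Bob's noiseless register of $c$ qudits, $\mathcal H_A$ is the Hilbert space of a register $A$. With ${\rm tr}:\mathbb F_q\to\mathbb F_p$ the trace and $\omega_p=e^{2\pi i/p}$: $X(a)|x\rangle=|x+a\rangle$, $Z(b)|x\rangle=\omega_p^{{\rm tr}(bx)}|x\rangle$; $X_A(\mathbf a)=\bigotimes_jX(a_j)$,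 $Z_A(\mathbf b)=\bigotimes_jZ(b_j)$. EA-CSS code. Given $\mathcal C_X,\mathcal C_Z$ with parity-check matrices $\mathbf H_X,\mathbf H_Z$, put $c=\mathrm{rank}(\mathbf H_X\mathbf H_Z^\top)$ and choose a rank factorization $-\mathbf H_X\mathbf H_Z^\top=\mathbf F_X\mathbf F_Z^\top$ with $\mathbf F_X\in\mathbb F_q^{(n-k_X)\times c}$, $\mathbf F_Z\in\mathbb F_q^{(n-k_Z)\times c}$. The EA-CSS code $\mathcal Q(\mathcal C_X,\mathcal C_Z)$ is the subspace of $\mathcal H_Q\otimes\mathcal H_B$ fixed pointwise by all operators $X_Q(\mathbf u\mathbf H_X)Z_Q(\mathbf v\mathbf H_Z)\otimes X_B(\mathbf u\mathbf F_X)Z_B(\mathbf v\mathbf F_Z)$ with $\mathbf u\in\mathbb F_q^{n-k_X},\mathbf v\in\mathbb F_q^{n-k_Z}$. CSS-like EAQLRC. $\mathcal Q(\mathcal C_X,\mathcal C_Z)$ is called a CSS-like EAQLRC when, for some integer $r'$, for every $i\in[n]$ there exist $\mathbf h_i^X\in\mathcal C_X^\perp$, $\mathbf h_i^Z\in\mathcal C_Z^\perp$ with $i\in\mathrm{supp}(\mathbf h_i^X)\cap\mathrm{supp}(\mathbf h_i^Z)$ and $|\mathrm{supp}(\mathbf h_i^X)\cup\mathrm{supp}(\mathbf h_i^Z)|\le r'+1$ (the paper shows that then $\mathcal Q(\mathcal C_X,\mathcal C_Z)$ has locality $r'$ in the sense below). Locality. $\mathcal M(A)$ is the set of density operators on $\mathcal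 H_A$; a quantum channel is a completely positive trace-preserving linear map. The erasure of qudit $i$ is $\Gamma_i(\rho)=\frac{I_{Q_i}}{q}\otimes{\rm Tr}_{Q_i}(\rho)$. A set $R\subseteq[n]\setminus\{i\}$ is a recovery set for $Q_i$ if there is a quantum channel ${\rm Rec}_{i,R}$ from $\mathcal M(Q_{\{i\}\cup R}\cup B_{[c]})$ to itself such that $({\rm Rec}_{i,R}\otimes{\rm id}_{Q_{[n]\setminus(\{i\}\cup R)}})(\Gamma_i(|\psi\rangle\langle\psi|))=|\psi\rangle\langle\psi|$ for every unit vector $|\psi\rangle$ in the code. The code has locality $r$ if for every $i\in[n]$ there is a recovery set $R_i\subseteq[n]\setminus\{i\}$ for $Q_i$ with $|R_i|\le r$. *)

theory Defs
  imports
    "Jordan_Normal_Form.DL_Rank"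
    "Jordan_Normal_Form.Matrix_Kernel"
    "HOL-Computational_Algebra.Primes"
    "HOL-Library.Cardinality"
    "HOL-Library.FuncSet"
    "HOL-Library.Extended_Nat"
begin

section \<open>Linear codes\<close>

text \<open>The field with \<open>q\<close> elements is a type of class \<^class>\<open>finite_field\<close>, with \<open>q = CARD('a)\<close>.
  Coordinates are numbered from \<open>0\<close> to \<open>n - 1\<close>.\<close>

definition supp :: "'a::zero vec \<Rightarrow> nat set" where
  "supp u = {i. i < dim_vec u \<and> u $ i \<noteq> 0}"

definition hamming_dist :: "'a vec \<Rightarrow> 'a vec \<Rightarrow> nat" where
  "hamming_dist u v = card {i. i < dim_vec u \<and> u $ i \<noteq> v $ i}"

text \<open>The zero code has no two distinct codewords; its minimum distance is \<open>\<infinity>\<close>.\<close>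

definition min_distance :: "'a vec set \<Rightarrow> enat" where
  "min_distance C = (INF (u, v) \<in> {(u, v). u \<in> C \<and> v \<in> C \<and> u \<noteq> v}. enat (hamming_dist u v))"

definition code_dim :: "nat \<Rightarrow> 'a::field vec set \<Rightarrow> nat" where
  "code_dim n C = vectorspace.dim class_ring ((module_vec TYPE('a) n)\<lparr>carrier := C\<rparr>)"

definition linear_code :: "nat \<Rightarrow> nat \<Rightarrow> enat \<Rightarrow> 'a::field vec set \<Rightarrow> bool" where
  "linear_code n k d C \<longleftrightarrow>
     VectorSpace.subspace class_ring C (module_vec TYPE('a) n) \<and>
     code_dim n C = k \<and> min_distance C = d"

definition dual_code :: "nat \<Rightarrow> 'a::field vec set \<Rightarrow> 'a vec set" where
  "dual_code n C = {v \<in> carrier_vec n. \<forall>u \<in> C. u \<bullet> v = 0}"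

definition parity_check_matrix :: "nat \<Rightarrow> 'a::field vec set \<Rightarrow> 'a mat \<Rightarrow> bool" where
  "parity_check_matrix n C H \<longleftrightarrow>
     H \<in> carrier_mat (n - code_dim n C) n \<and>
     C = mat_kernel H \<and> dual_code n C = vec_space.row_space n H"

definition rank_factorization :: "'a::field mat \<Rightarrow> nat \<Rightarrow> 'a mat \<Rightarrow> 'a mat \<Rightarrow> bool" where
  "rank_factorization M c F G \<longleftrightarrow>
     c = vec_space.rank (dim_row M) M \<and>
     F \<in> carrier_mat (dim_row M) c \<and> G \<in> carrier_mat (dim_col M) c \<and>
     M = F * G\<^sup>T"

section \<open>Registers, states and operators\<close>

text \<open>\<open>Q j\<close> are the transmitted qudits, \<open>B j\<close> the noiseless ones held by Bob.\<close>

datatype qudit = Q nat | B nat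

definition reg_Q :: "nat set \<Rightarrow> qudit set" where
  "reg_Q J = Q ` J"

definition reg_B :: "nat \<Rightarrow> qudit set" where
  "reg_B c = B ` {..<c}"

text \<open>The computational basis of the Hilbert space of a register \<open>A\<close>: one field element per qudit.\<close>

type_synonym 'a config = "qudit \<Rightarrow> 'a"

definition configs :: "qudit set \<Rightarrow> 'a config set" where
  "configs A = (A \<rightarrow>\<^sub>E UNIV)"

text \<open>For a finite set \<open>I\<close>, the space \<open>\<complex>\<^sup>I\<close> and the linear operators on it, the latter as matrices
  of entries \<open>M x y = \<langle>x|M|y\<rangle>\<close>. Everything vanishes off \<open>I\<close>, so that HOL equality is
  equality of vectors and of operators.\<close>

type_synonym 'i ket = "'i \<Rightarrow> complex"
type_synonym 'i oper = "'i \<Rightarrow> 'i \<Rightarrow> complex"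

definition kets :: "'i set \<Rightarrow> 'i ket set" where
  "kets I = {\<psi>. \<forall>x. x \<notin> I \<longrightarrow> \<psi> x = 0}"

definition opers :: "'i set \<Rightarrow> 'i oper set" where
  "opers I = {M. \<forall>x y. x \<notin> I \<or> y \<notin> I \<longrightarrow> M x y = 0}"

definition restrict_oper :: "'i set \<Rightarrow> 'i oper \<Rightarrow> 'i oper" where
  "restrict_oper I M = (\<lambda>x y. if x \<in> I \<and> y \<in> I then M x y else 0)"

definition oper_apply :: "'i set \<Rightarrow> 'i oper \<Rightarrow> 'i ket \<Rightarrow> 'i ket" where
  "oper_apply I M \<psi> = (\<lambda>x. \<Sum>y\<in>I. M x y * \<psi> y)"

definition oper_mult :: "'i set \<Rightarrow> 'i oper \<Rightarrow> 'i oper \<Rightarrow> 'i oper" where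
  "oper_mult I M N = (\<lambda>x y. \<Sum>z\<in>I. M x z * N z y)"

definition oper_trace :: "'i set \<Rightarrow> 'i oper \<Rightarrow> complex" where
  "oper_trace I M = (\<Sum>x\<in>I. M x x)"

definition positive_oper :: "'i set \<Rightarrow> 'i oper \<Rightarrow> bool" where
  "positive_oper I M \<longleftrightarrow> M \<in> opers I \<and>
     (\<forall>\<psi>. (\<Sum>x\<in>I. \<Sum>y\<in>I. cnj (\<psi> x) * M x y * \<psi> y) \<in> \<real> \<and>
          0 \<le> Re (\<Sum>x\<in>I. \<Sum>y\<in>I. cnj (\<psi> x) * M x y * \<psi> y))"

definition unit_ket :: "'i set \<Rightarrow> 'i ket \<Rightarrow> bool" where
  "unit_ket I \<psi> \<longleftrightarrow> \<psi> \<in> kets I \<and> (\<Sum>x\<in>I. (cmod (\<psi> x))\<^sup>2) = 1"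

definition ketbra :: "'i ket \<Rightarrow> 'i oper" where
  "ketbra \<psi> = (\<lambda>x y. \<psi> x * cnj (\<psi> y))"

text \<open>\<open>S \<otimes> T\<close> for operators on disjoint registers \<open>A\<close> and \<open>A'\<close>.\<close>

definition oper_tensor ::
    "qudit set \<Rightarrow> 'a config oper \<Rightarrow> qudit set \<Rightarrow> 'a config oper \<Rightarrow> 'a config oper" where
  "oper_tensor A S A' T = restrict_oper (configs (A \<union> A'))
     (\<lambda>x y. S (restrict x A) (restrict y A) * T (restrict x A') (restrict y A'))"

section \<open>Channels\<close>

text \<open>\<open>\<Phi> \<otimes> id\<close> with an ancilla of dimension \<open>d\<close>: apply \<open>\<Phi>\<close> to each block.\<close>

definition amplify ::
    "'i set \<Rightarrow> nat \<Rightarrow> ('i oper \<Rightarrow> 'i oper) \<Rightarrow> ('i \<times> nat) oper \<Rightarrow> ('i \<times> nat) oper" where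
  "amplify I d \<Phi> M = restrict_oper (I \<times> {..<d})
     (\<lambda>(x, e) (y, f). \<Phi> (restrict_oper I (\<lambda>a b. M (a, e) (b, f))) x y)"

definition completely_positive :: "'i set \<Rightarrow> ('i oper \<Rightarrow> 'i oper) \<Rightarrow> bool" where
  "completely_positive I \<Phi> \<longleftrightarrow>
     (\<forall>d M. positive_oper (I \<times> {..<d}) M \<longrightarrow> positive_oper (I \<times> {..<d}) (amplify I d \<Phi> M))"

definition linear_on_opers :: "'i set \<Rightarrow> ('i oper \<Rightarrow> 'i oper) \<Rightarrow> bool" where
  "linear_on_opers I \<Phi> \<longleftrightarrow>
     (\<forall>M \<in> opers I. \<Phi> M \<in> opers I) \<and>
     (\<forall>M \<in> opers I. \<forall>N \<in> opers I. \<Phi> (\<lambda>x y. M x y + N x y) = (\<lambda>x y. \<Phi> M x y + \<Phi> N x y)) \<and>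
     (\<forall>a. \<forall>M \<in> opers I. \<Phi> (\<lambda>x y. a * M x y) = (\<lambda>x y. a * \<Phi> M x y))"

definition trace_preserving :: "'i set \<Rightarrow> ('i oper \<Rightarrow> 'i oper) \<Rightarrow> bool" where
  "trace_preserving I \<Phi> \<longleftrightarrow> (\<forall>M \<in> opers I. oper_trace I (\<Phi> M) = oper_trace I M)"

definition quantum_channel :: "'i set \<Rightarrow> ('i oper \<Rightarrow> 'i oper) \<Rightarrow> bool" where
  "quantum_channel I \<Phi> \<longleftrightarrow>
     linear_on_opers I \<Phi> \<and> completely_positive I \<Phi> \<and> trace_preserving I \<Phi>"

text \<open>\<open>\<Phi> \<otimes> id\<close>, where \<open>\<Phi>\<close> acts on the register \<open>A\<close> and \<open>id\<close> on the disjoint register \<open>W\<close>.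
  The configuration \<open>override_on x a A\<close> is \<open>a\<close> on \<open>A\<close> and \<open>x\<close> on \<open>W\<close>.\<close>

definition channel_tensor_id ::
    "qudit set \<Rightarrow> ('a config oper \<Rightarrow> 'a config oper) \<Rightarrow> qudit set
      \<Rightarrow> 'a config oper \<Rightarrow> 'a config oper" where
  "channel_tensor_id A \<Phi> W M = restrict_oper (configs (A \<union> W))
     (\<lambda>x y. \<Phi> (restrict_oper (configs A) (\<lambda>a b. M (override_on x a A) (override_on y b A)))
              (restrict x A) (restrict y A))"

definition partial_trace :: "qudit set \<Rightarrow> qudit \<Rightarrow> ('a::finite) config oper \<Rightarrow> 'a config oper" where
  "partial_trace A l M = restrict_oper (configs (A - {l}))
     (\<lambda>x y. \<Sum>a\<in>UNIV. M (x(l := a)) (y(l := a)))"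

definition maximally_mixed :: "qudit \<Rightarrow> ('a::finite) config oper" where
  "maximally_mixed l = restrict_oper (configs {l})
     (\<lambda>x y. if x = y then 1 / of_nat CARD('a) else 0)"

definition erasure :: "qudit set \<Rightarrow> qudit \<Rightarrow> ('a::finite) config oper \<Rightarrow> 'a config oper" where
  "erasure A l M = oper_tensor {l} (maximally_mixed l) (A - {l}) (partial_trace A l M)"

section \<open>Pauli operators\<close>

text \<open>The trace from \<open>'a\<close> to its prime field, as an element of \<open>'a\<close>.\<close>

definition field_trace :: "'a::finite_field \<Rightarrow> 'a" where
  "field_trace x = (\<Sum>j < (THE m. CARD('a) = CHAR('a) ^ m). x ^ (CHAR('a) ^ j))"

text \<open>The prime field is identified with \<open>{0..<p}\<close>, so this is \<open>exp (2 \<pi> \<i> tr x / p)\<close>.\<close>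

definition trace_char :: "'a::finite_field \<Rightarrow> complex" where
  "trace_char x =
     cis (2 * pi * real (THE t. t < CHAR('a) \<and> of_nat t = field_trace x) / real CHAR('a))"

definition pauli_X1 :: "'a::finite_field \<Rightarrow> 'a oper" where
  "pauli_X1 a = (\<lambda>y x. if y = x + a then 1 else 0)"

definition pauli_Z1 :: "'a::finite_field \<Rightarrow> 'a oper" where
  "pauli_Z1 b = (\<lambda>y x. if y = x then trace_char (b * x) else 0)"

text \<open>Tensor products of Paulis on the register whose \<open>j\<close>-th qudit is \<open>l j\<close>, for
  \<open>l = Q\<close> or \<open>l = B\<close>.\<close>

definition pauli_X :: "(nat \<Rightarrow> qudit) \<Rightarrow> 'a::finite_field vec \<Rightarrow> 'a config oper" where
  "pauli_X l a = restrict_oper (configs (l ` {..<dim_vec a}))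
     (\<lambda>y x. \<Prod>j<dim_vec a. pauli_X1 (a $ j) (y (l j)) (x (l j)))"

definition pauli_Z :: "(nat \<Rightarrow> qudit) \<Rightarrow> 'a::finite_field vec \<Rightarrow> 'a config oper" where
  "pauli_Z l b = restrict_oper (configs (l ` {..<dim_vec b}))
     (\<lambda>y x. \<Prod>j<dim_vec b. pauli_Z1 (b $ j) (y (l j)) (x (l j)))"

section \<open>The entanglement-assisted CSS code\<close>

text \<open>The row vector \<open>u M\<close> is \<open>M\<^sup>T *\<^sub>v u\<close>.\<close>

definition ea_stabilizer ::
    "'a::finite_field mat \<Rightarrow> 'a mat \<Rightarrow> 'a mat \<Rightarrow> 'a mat \<Rightarrow> 'a vec \<Rightarrow> 'a vec \<Rightarrow> 'a config oper" where
  "ea_stabilizer H_X H_Z F_X F_Z u v =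
    (let RQ = reg_Q {..<dim_col H_X}; RB = reg_B (dim_col F_X)
     in oper_tensor
          RQ (oper_mult (configs RQ) (pauli_X Q (H_X\<^sup>T *\<^sub>v u)) (pauli_Z Q (H_Z\<^sup>T *\<^sub>v v)))
          RB (oper_mult (configs RB) (pauli_X B (F_X\<^sup>T *\<^sub>v u)) (pauli_Z B (F_Z\<^sup>T *\<^sub>v v))))"

definition ea_css_code ::
    "'a::finite_field mat \<Rightarrow> 'a mat \<Rightarrow> 'a mat \<Rightarrow> 'a mat \<Rightarrow> 'a config ket set" where
  "ea_css_code H_X H_Z F_X F_Z =
    (let I = configs (reg_Q {..<dim_col H_X} \<union> reg_B (dim_col F_X))
     in {\<psi> \<in> kets I.
          \<forall>u \<in> carrier_vec (dim_row H_X). \<forall>v \<in> carrier_vec (dim_row H_Z).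
            oper_apply I (ea_stabilizer H_X H_Z F_X F_Z u v) \<psi> = \<psi>})"

definition css_like_EAQLRC :: "nat \<Rightarrow> 'a::finite_field vec set \<Rightarrow> 'a vec set \<Rightarrow> bool" where
  "css_like_EAQLRC n C_X C_Z \<longleftrightarrow>
     (\<exists>r. \<forall>i<n. \<exists>hX \<in> dual_code n C_X. \<exists>hZ \<in> dual_code n C_Z.
        i \<in> supp hX \<inter> supp hZ \<and> card (supp hX \<union> supp hZ) \<le> r + 1)"

section \<open>Locality\<close>

text \<open>Here \<open>\<C>\<close> is a subspace of the Hilbert space of \<open>n\<close> transmitted and \<open>c\<close> noiseless qudits.\<close>

definition recovery_set ::
    "nat \<Rightarrow> nat \<Rightarrow> ('a::finite) config ket set \<Rightarrow> nat \<Rightarrow> nat set \<Rightarrow> bool" where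
  "recovery_set n c \<C> i R \<longleftrightarrow> R \<subseteq> {..<n} - {i} \<and>
     (\<exists>Rec. quantum_channel (configs (reg_Q ({i} \<union> R) \<union> reg_B c)) Rec \<and>
        (\<forall>\<psi> \<in> \<C>. unit_ket (configs (reg_Q {..<n} \<union> reg_B c)) \<psi> \<longrightarrow>
           channel_tensor_id (reg_Q ({i} \<union> R) \<union> reg_B c) Rec (reg_Q ({..<n} - ({i} \<union> R)))
             (erasure (reg_Q {..<n} \<union> reg_B c) (Q i) (ketbra \<psi>)) = ketbra \<psi>))"

definition has_locality :: "nat \<Rightarrow> nat \<Rightarrow> ('a::finite) config ket set \<Rightarrow> nat \<Rightarrow> bool" where
  "has_locality n c \<C> r \<longleftrightarrow> (\<forall>i<n. \<exists>R. recovery_set n c \<C> i R \<and> card R \<le> r)"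

definition min_locality :: "nat \<Rightarrow> nat \<Rightarrow> ('a::finite) config ket set \<Rightarrow> nat" where
  "min_locality n c \<C> = (LEAST r. has_locality n c \<C> r)"

end

theory Submission
  imports Defs "HOL-Number_Theory.Cong"
begin

text \<open>Fix a coordinate \<open>i\<close> and take a minimal set \<open>J\<close> of other coordinates on which the code
  \<open>C_X + C_Z\<close>, punctured at \<open>i\<close>, is determined; then \<open>|J| \<le> k_X + k_Z - dim (C_X \<inter> C_Z)\<close>. A word of
  \<open>C_X\<close> vanishing on \<open>J\<close> vanishes off \<open>i\<close>, hence is zero because \<open>d_X \<ge> 2\<close>; so its entry at \<open>i\<close> is a
  linear function of its entries on \<open>J\<close>, which is a word of the dual code with \<open>i\<close> in its support and
  support inside \<open>J \<union> {i}\<close>. The same \<open>J\<close> serves \<open>C_Z\<close>.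

  The two dual words yield stabilizers acting on \<open>J\<close>, \<open>i\<close> and Bob's qudits. They force every code state
  \<open>\<psi>\<close> to be supported on the configurations \<open>x\<close> with \<open>l \<cdot> x = 0\<close> and to satisfy \<open>\<psi> (x + s g) = \<psi> x\<close>,
  where \<open>l i \<noteq> 0\<close>, \<open>g i = 1\<close> and, since stabilizers commute, \<open>l \<cdot> g = 0\<close>. After the erasure the lost
  value \<open>x i\<close> can still be read off from \<open>l \<cdot> x = 0\<close>, so the state has only been dephased in that
  value; translating along \<open>g\<close> to a fixed value and then spreading coherently over all translates
  restores it.\<close>

section \<open>The additive character of a finite field\<close>

text \<open>A maximal additive subgroup of \<open>CHAR\<close>-power order is everything: an element \<open>x\<close> outside
  it would generate one that is \<open>CHAR\<close> times larger.\<close>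

lemma card_finite_field:
  obtains m where "CARD('a::finite_field) = CHAR('a) ^ m"
proof -
  let ?p = "CHAR('a)"
  define P where "P k \<longleftrightarrow> (\<exists>S::'a set. 0 \<in> S \<and> (\<forall>x\<in>S. \<forall>y\<in>S. x - y \<in> S) \<and> card S = ?p ^ k)" for k
  have p2: "?p \<ge> 2" using prime_ge_2_nat[of ?p] by simp
  have bound: "k \<le> CARD('a)" if Pk: "P k" for k
  proof -
    obtain S :: "'a set" where S: "card S = ?p ^ k" using Pk unfolding P_def by blast
    have "?p ^ k \<le> CARD('a)" using S card_mono[of UNIV S] by simp
    moreover have "k < ?p ^ k" using p2 by (intro power_gt_expt) auto
    ultimately show ?thesis by simp
  qed
  have "P 0" unfolding P_def by (intro exI[of _ "{0}"]) auto
  then obtain k where k: "P k" and max: "\<And>j. P j \<Longrightarrow> j \<le> k"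
    using bound GreatestI_nat[of P 0] Greatest_le_nat[of P] by metis
  obtain S :: "'a set" where S: "0 \<in> S" "\<And>x y. x \<in> S \<Longrightarrow> y \<in> S \<Longrightarrow> x - y \<in> S" "card S = ?p ^ k"
    using k unfolding P_def by blast
  have uminus: "- x \<in> S" if "x \<in> S" for x using S(2)[OF S(1) that] by simp
  have plus: "x + y \<in> S" if "x \<in> S" "y \<in> S" for x y
    using S(2)[OF that(1) uminus[OF that(2)]] by simp
  have mult: "of_nat t * x \<in> S" if "x \<in> S" for x t
    by (induction t) (auto simp: S(1) algebra_simps intro: plus that)
  have "S = UNIV"
  proof (rule ccontr)
    assume "S \<noteq> UNIV"
    then obtain x where x: "x \<notin> S" by auto
    define f where "f = (\<lambda>(s, t). s + of_nat t * x)"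
    \<comment> \<open>If \<open>t \<noteq> t'\<close>, then \<open>t - t'\<close> is invertible
      modulo the characteristic, and multiplying the difference by an inverse puts \<open>x\<close>
      itself into \<open>S\<close>.\<close>
    have key: "t = t'" if "of_nat t * x - of_nat t' * x \<in> S" "t < ?p" "t' \<le> t" for t t'
    proof (rule ccontr)
      assume "t \<noteq> t'"
      then have d: "0 < t - t'" "t - t' < ?p" using that(2,3) by linarith+
      have "\<not> ?p dvd (t - t')" using d by (auto dest: dvd_imp_le)
      then have "coprime (t - t') ?p"
        using prime_imp_coprime_nat[of ?p "t - t'"] by (simp add: coprime_commute)
      then obtain u where "[(t - t') * u = 1] (mod ?p)" 
        using cong_solve_coprime_nat by fastforce
      then have "of_nat ((t - t') * u) = (1::'a)"
        using of_nat_eq_iff_cong_CHAR[where 'a='a, of "(t - t') * u" 1] by simp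
      then have "of_nat u * of_nat (t - t') = (1::'a)" by (simp only: of_nat_mult mult.commute)
      then have "x = of_nat u * (of_nat (t - t') * x)" by (simp flip: mult.assoc)
      also have "of_nat (t - t') * x = of_nat t * x - of_nat t' * x"
        using that(3) by (simp add: of_nat_diff left_diff_distrib)
      finally have "x \<in> S" using mult[OF that(1), of u] by simp
      then show False using x by simp
    qed
    have "inj_on f (S \<times> {..<?p})"
    proof (rule inj_onI, clarsimp simp: f_def)
      fix s t s' t' assume a: "s \<in> S" "t < ?p" "s' \<in> S" "t' < ?p" and e: "s + of_nat t * x = s' + of_nat t' * x"
      have "of_nat t * x - of_nat t' * x = s' - s" "of_nat t' * x - of_nat t * x = s - s'"
        using e by (simp_all add: algebra_simps)
      then have "of_nat t * x - of_nat t' * x \<in> S" "of_nat t' * x - of_nat t * x \<in> S" using S(2) a by auto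
      then have "t = t'" using key[of t t'] key[of t' t] a by (cases "t' \<le> t") auto
      then show "s = s' \<and> t = t'" using e by simp
    qed
    then have c: "card (f ` (S \<times> {..<?p})) = ?p ^ Suc k"
      by (simp add: card_image card_cartesian_product S(3))
    have "s + of_nat t * x - (s' + of_nat t' * x) \<in> f ` (S \<times> {..<?p})"
      if "s \<in> S" "s' \<in> S" "t < ?p" "t' < ?p" for s s' t t'
    proof -
      \<comment> \<open>A representative of \<open>t - t'\<close> in the range
        \<open>{..<?p}\<close>; adding \<open>?p\<close> first keeps the natural subtraction
        exact.\<close>
      let ?t = "(t + (?p - t')) mod ?p"
      have "(of_nat ?t :: 'a) = of_nat (t + (?p - t'))"
        by (subst of_nat_eq_iff_cong_CHAR) (simp add: cong_def)
      also have "\<dots> = of_nat t - of_nat t'" using that by (simp add: of_nat_diff)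
      finally have "f (s - s', ?t) = s - s' + (of_nat t - of_nat t') * x"
        by (simp add: f_def)
      then have "s + of_nat t * x - (s' + of_nat t' * x) = f (s - s', ?t)"
        by (simp add: algebra_simps)
      moreover have "(s - s', ?t) \<in> S \<times> {..<?p}" using S(2) that by simp
      ultimately show ?thesis by blast
    qed
    then have "\<forall>y\<in>f ` (S \<times> {..<?p}). \<forall>z\<in>f ` (S \<times> {..<?p}). y - z \<in> f ` (S \<times> {..<?p})"
      by (auto simp: f_def)
    moreover have "0 \<in> f ` (S \<times> {..<?p})"
      using S(1) by (intro image_eqI[of _ _ "(0,0)"]) (simp_all add: f_def)
    ultimately have "P (Suc k)"
      unfolding P_def using c by (intro exI[of _ "f ` (S \<times> {..<?p})"] conjI)
    from max[OF this] show False by simp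
  qed
  then show ?thesis using S(3) that by simp
qed

section \<open>The trace into the prime field and the character it defines\<close>

lemma field_trace_eq:
  assumes "CARD('a::finite_field) = CHAR('a) ^ m"
  shows "field_trace (x::'a) = (\<Sum>j<m. x ^ (CHAR('a) ^ j))"
proof -
  have "CHAR('a) > 1" by (rule prime_gt_1_nat) simp
  then have "(THE m. CARD('a) = CHAR('a) ^ m) = m"
    using assms by (intro the_equality) auto
  then show ?thesis by (simp add: field_trace_def)
qed

lemma field_trace_add: "field_trace (x + y) = field_trace x + field_trace (y::'a::finite_field)"
proof -
  obtain m where m: "CARD('a) = CHAR('a) ^ m" by (rule card_finite_field)
  show ?thesis unfolding field_trace_eq[OF m]
    by (simp add: freshmans_dream'[OF CHAR_prime refl] sum.distrib)
qed

text \<open>Frobenius shifts the powers in the trace cyclically, because \<open>x\<close> to the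
  power \<open>CARD('a)\<close> is \<open>x\<close>; so the trace is a root of X^p - X. The images
  of \<open>0, ..., p - 1\<close> are p distinct roots of this polynomial of degree at most p, hence
  all of them.\<close>

lemma field_trace_in_prime_field:
  "\<exists>!t. t < CHAR('a) \<and> of_nat t = field_trace (x::'a::finite_field)"
proof -
  let ?p = "CHAR('a)"
  obtain m where m: "CARD('a) = ?p ^ m" by (rule card_finite_field)
  have "field_trace x ^ ?p = (\<Sum>j<m. (x ^ (?p ^ j)) ^ ?p)"
    unfolding field_trace_eq[OF m] by (rule freshmans_dream_sum) (rule CHAR_prime refl)+
  also have "\<dots> = (\<Sum>j<m. x ^ (?p ^ Suc j))"
    by (simp add: mult.commute flip: power_mult)
  also have "\<dots> = (\<Sum>j<Suc m. x ^ (?p ^ j)) - x"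
    by (subst sum.lessThan_Suc_shift) simp
  also have "\<dots> = field_trace x"
    using finite_field_power_card_eq_same[of x] by (simp add: field_trace_eq[OF m] m)
  finally have tr: "field_trace x ^ ?p = field_trace x" .
  define q :: "'a poly" where "q = monom 1 ?p - monom 1 1"
  have p2: "?p \<ge> 2" using prime_ge_2_nat[of ?p] by simp
  have "coeff q ?p = 1" using p2 by (auto simp: q_def)
  then have q0: "q \<noteq> 0" by auto
  have "degree q \<le> ?p" unfolding q_def using p2
    by (intro degree_diff_le order.trans[OF degree_monom_le]) auto
  then have c: "card {z. poly q z = 0} \<le> ?p" using card_poly_roots_bound[OF q0] by simp
  have poly_q: "poly q z = z ^ ?p - z" for z by (simp add: q_def poly_monom)
  have inj: "inj_on (of_nat :: nat \<Rightarrow> 'a) {..<?p}"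
    by (auto simp: inj_on_def of_nat_eq_iff_cong_CHAR cong_def)
  have "(of_nat t :: 'a) ^ ?p = of_nat t" for t
    by (induction t) (simp_all add: freshmans_dream[OF CHAR_prime refl])
  then have sub: "of_nat ` {..<?p} \<subseteq> {z. poly q z = 0}" by (auto simp: poly_q)
  have "of_nat ` {..<?p} = {z. poly q z = 0}"
    using c by (intro card_seteq sub) (auto simp: card_image[OF inj])
  moreover have "field_trace x \<in> {z. poly q z = 0}" using tr by (simp add: poly_q)
  ultimately obtain t where t: "t < ?p" "of_nat t = field_trace x" by (metis (no_types, lifting) imageE lessThan_iff)
  then show ?thesis using inj by (metis inj_onD lessThan_iff)
qed

text \<open>The representative \<open>t\<close> need not be below the characteristic, as
  \<open>cis\<close> only sees it modulo p. Additivity then follows by adding representatives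
  without reducing the sum.\<close>

lemma trace_char_eq:
  assumes "of_nat t = field_trace (x::'a::finite_field)"
  shows "trace_char x = cis (2 * pi * real t / real CHAR('a))"
proof -
  let ?p = "CHAR('a)"
  have "t mod ?p < ?p \<and> of_nat (t mod ?p) = field_trace x"
    by (auto simp: of_nat_eq_iff_cong_CHAR cong_def simp flip: assms)
  then have eq: "(THE t. t < ?p \<and> of_nat t = field_trace x) = t mod ?p"
    using field_trace_in_prime_field[of x] by (rule the1_equality[rotated])
  have "real t = real (t mod ?p) + real ?p * real (t div ?p)"
    by (metis mod_mult_div_eq of_nat_add of_nat_mult)
  then have "2 * pi * real t / real ?p = 2 * pi * real (t mod ?p) / real ?p + 2 * pi * real (t div ?p)"
    by (simp add: field_simps)
  then have "cis (2 * pi * real t / real ?p)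
      = cis (2 * pi * real (t mod ?p) / real ?p) * cis (2 * pi * real (t div ?p))"
    by (simp only: cis_mult)
  moreover have "cis (2 * pi * real (t div ?p)) = 1" by (rule cis_multiple_2pi) simp
  ultimately have "cis (2 * pi * real t / real ?p) = cis (2 * pi * real (t mod ?p) / real ?p)"
    by simp
  then show ?thesis by (simp add: trace_char_def eq)
qed

lemma trace_char_add: "trace_char (x + y) = trace_char x * trace_char (y::'a::finite_field)"
proof -
  obtain s t where st: "of_nat s = field_trace x" "of_nat t = field_trace y"
    using field_trace_in_prime_field by metis
  then have "of_nat (s + t) = field_trace (x + y)" by (simp add: field_trace_add)
  from trace_char_eq[OF this] show ?thesis
    by (simp add: trace_char_eq[OF st(1)] trace_char_eq[OF st(2)] cis_mult field_simps)
qed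

lemma trace_char_0 [simp]: "trace_char (0::'a::finite_field) = 1"
proof -
  have "field_trace (0::'a) = 0" using field_trace_add[of "0::'a" 0] by (metis add.right_neutral add_cancel_left_right)
  then show ?thesis using trace_char_eq[of 0 "0::'a"] by simp
qed

lemma trace_char_sum: "trace_char (\<Sum>i\<in>I. f i) = (\<Prod>i\<in>I. trace_char (f i :: 'a::finite_field))"
  by (induction I rule: infinite_finite_induct) (auto simp: trace_char_add)

text \<open>For the representative \<open>t\<close> below p, the angle is a multiple of a full turn
  only if p divides \<open>t\<close>, that is, if \<open>t = 0\<close>.\<close>

lemma trace_char_eq_1_iff: "trace_char x = 1 \<longleftrightarrow> field_trace (x::'a::finite_field) = 0"
proof -
  obtain t where t: "t < CHAR('a)" "of_nat t = field_trace x"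
    using field_trace_in_prime_field by metis
  show ?thesis
  proof (cases "t = 0")
    case True
    then show ?thesis using t trace_char_eq[OF t(2)] by simp
  next
    case False
    then have "(of_nat t :: 'a) \<noteq> 0" using t(1) by (auto simp: of_nat_eq_0_iff_char_dvd dest: dvd_imp_le)
    moreover have "cis (2 * pi * real t / real CHAR('a)) \<noteq> 1"
    proof
      assume "cis (2 * pi * real t / real CHAR('a)) = 1"
      then have "cos (2 * pi * real t / real CHAR('a)) = 1" by (metis cis.sel(1) one_complex.sel(1))
      then obtain k :: int where "2 * pi * real t / real CHAR('a) = of_int k * 2 * pi"
        using cos_one_2pi_int by auto
      then have "real t = of_int k * real CHAR('a)" by (simp add: field_simps)
      then have e: "int t = k * int CHAR('a)" by (metis of_int_eq_iff of_int_mult of_int_of_nat_eq)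
      then have "int CHAR('a) dvd int t" by simp
      then have "CHAR('a) dvd t" by presburger
      then show False using False t(1) by (auto dest: dvd_imp_le)
    qed
    ultimately show ?thesis using t trace_char_eq[OF t(2)] by simp
  qed
qed

text \<open>If \<open>x\<close> were nonzero, \<open>b * x\<close> would run through the whole field
  and the trace would vanish identically. But the trace is a nonzero polynomial of degree at most
  p^(m-1), too few for p^m roots. This later turns trivial phases into a linear equation.\<close>

lemma trace_char_nontrivial:
  assumes "\<And>b. trace_char (b * x) = 1"
  shows "x = (0::'a::finite_field)"
proof (rule ccontr)
  assume x: "x \<noteq> 0"
  obtain m where m: "CARD('a) = CHAR('a) ^ m" by (rule card_finite_field)
  let ?p = "CHAR('a)"
  have p2: "?p \<ge> 2" using prime_ge_2_nat[of ?p] by simp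
  have m0: "m \<noteq> 0"
  proof
    assume "m = 0"
    then have "card {0, 1 :: 'a} \<le> 1" using m card_mono[of UNIV "{0, 1 :: 'a}"] by simp
    then show False by simp
  qed
  have tr0: "field_trace y = 0" for y :: 'a
    using assms[of "y / x"] x by (simp add: trace_char_eq_1_iff)
  define q :: "'a poly" where "q = (\<Sum>j<m. monom 1 (?p ^ j))"
  \<comment> \<open>Only the term \<open>j = 0\<close> of the trace polynomial has degree 1, so the
    linear coefficient certifies that the polynomial is nonzero.\<close>
  have "coeff q 1 = (\<Sum>j<m. if j = 0 then 1 else 0)"
    unfolding q_def coeff_sum using p2 by (intro sum.cong) auto
  then have "coeff q 1 = 1" using m0 by simp
  then have q0: "q \<noteq> 0" by auto
  have "degree q \<le> ?p ^ (m - 1)" unfolding q_def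
    using m0 p2 by (intro degree_sum_le order.trans[OF degree_monom_le] power_increasing) auto
  moreover have "{z. poly q z = 0} = UNIV"
    using tr0 by (simp add: q_def poly_sum poly_monom field_trace_eq[OF m])
  ultimately have "CARD('a) \<le> ?p ^ (m - 1)" using card_poly_roots_bound[OF q0] by simp
  moreover have "?p ^ (m - 1) < ?p ^ m" using p2 m0 by (intro power_strict_increasing) auto
  ultimately show False using m by simp
qed

section \<open>Dual words of small support\<close>

abbreviation vec_subspace :: "nat \<Rightarrow> 'a::field vec set \<Rightarrow> bool" where
  "vec_subspace n C \<equiv> VectorSpace.subspace class_ring C (module_vec TYPE('a) n)"

lemma vec_subspaceD:
  assumes "vec_subspace n C"
  shows "C \<subseteq> carrier_vec n" "0\<^sub>v n \<in> C"
    and "\<And>x y. x \<in> C \<Longrightarrow> y \<in> C \<Longrightarrow> x + y \<in> C" "\<And>a x. x \<in> C \<Longrightarrow> a \<cdot>\<^sub>v x \<in> C"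
proof -
  have s: "submodule class_ring C (module_vec TYPE('a) n)"
    using assms by (simp add: VectorSpace.subspace_def)
  show "C \<subseteq> carrier_vec n" "0\<^sub>v n \<in> C"
    and "\<And>x y. x \<in> C \<Longrightarrow> y \<in> C \<Longrightarrow> x + y \<in> C" "\<And>a x. x \<in> C \<Longrightarrow> a \<cdot>\<^sub>v x \<in> C"
    using submodule.subset[OF s] submodule.zero_closed[OF s] submodule.m_closed[OF s]
      submodule.smult_closed[OF s]
    by (auto simp: module_vec_simps class_ring_simps)
qed

lemma vec_subspace_inter:
  assumes "vec_subspace n C" "vec_subspace n D"
  shows "vec_subspace n (C \<inter> D)"
proof -
  have s: "submodule class_ring C (module_vec TYPE('a) n)" "submodule class_ring D (module_vec TYPE('a) n)"
    using assms by (simp_all add: VectorSpace.subspace_def)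
  have "submodule class_ring (C \<inter> D) (module_vec TYPE('a) n)"
    by (rule submodule.intro)
      (use submodule.module[OF s(1)] submodule.subset[OF s(1)] submodule.zero_closed[OF s(1)]
        submodule.m_closed[OF s(1)] submodule.smult_closed[OF s(1)] submodule.zero_closed[OF s(2)]
        submodule.m_closed[OF s(2)] submodule.smult_closed[OF s(2)] in auto)
  then show ?thesis using assms by (simp add: VectorSpace.subspace_def)
qed

lemma vec_subspace_sum:
  assumes C: "vec_subspace n C" and "finite J" and "\<And>j. j \<in> J \<Longrightarrow> w j \<in> C"
  shows "vec n (\<lambda>i. \<Sum>j\<in>J. a j * w j $ i) \<in> C"
  using assms(2,3)
proof (induction J rule: finite_induct)
  case empty
  have "vec n (\<lambda>i. 0) = (0\<^sub>v n :: 'a vec)" by auto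
  then show ?case using vec_subspaceD(2)[OF C] by simp
next
  case (insert k J)
  have "w k \<in> carrier_vec n" using insert.prems[of k] vec_subspaceD(1)[OF C] by auto
  then have "vec n (\<lambda>i. \<Sum>j\<in>insert k J. a j * w j $ i) = a k \<cdot>\<^sub>v w k + vec n (\<lambda>i. \<Sum>j\<in>J. a j * w j $ i)"
    using insert.hyps by (intro eq_vecI) auto
  then show ?case using insert vec_subspaceD(3,4)[OF C] by simp
qed

lemma finite_carrier_vec: "finite (carrier_vec n :: 'a::finite vec set)"
proof (rule finite_subset)
  show "(carrier_vec n :: 'a vec set) \<subseteq> vec n ` ({..<n} \<rightarrow>\<^sub>E UNIV)"
  proof
    fix v :: "'a vec" assume v: "v \<in> carrier_vec n"
    show "v \<in> vec n ` ({..<n} \<rightarrow>\<^sub>E UNIV)"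
    proof (rule image_eqI)
      show "v = vec n (restrict (\<lambda>i. v $ i) {..<n})"
        using v by (intro eq_vecI) auto
    qed simp
  qed
  show "finite (vec n ` ({..<n} \<rightarrow>\<^sub>E (UNIV :: 'a set)))" by (intro finite_imageI finite_PiE) auto
qed

text \<open>Coordinates with respect to a basis are in bijection with the codewords. Dimension
  inequalities can then be proved by counting.\<close>

lemma card_vec_subspace:
  fixes C :: "'a::finite_field vec set"
  assumes C: "vec_subspace n C"
  shows "card C = CARD('a) ^ code_dim n C"
proof -
  interpret V: vec_space "TYPE('a)" n .
  interpret W: vectorspace class_ring "V.vs C" by (rule V.subspace_is_vs[OF C])
  have fin: "finite C" using finite_subset[OF vec_subspaceD(1)[OF C] finite_carrier_vec] .
  \<comment> \<open>The code is a finite generating set of itself, which yields a finite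
    basis.\<close>
  have "W.span C = C"
    using W.in_own_span[of C] W.span_closed[of C] by auto
  then have "W.fin_dim" unfolding W.fin_dim_def using fin by auto
  then obtain B where B: "finite B" "W.basis B" using W.finite_basis_exists by blast
  have Bc: "B \<subseteq> C" using B(2) by (auto simp: W.basis_def)
  have uniq: "\<exists>!a. a \<in> B \<rightarrow>\<^sub>E UNIV \<and> W.lincomb a B = v" if "v \<in> C" for v
    using W.basis_criterion[OF B(1)] B(2) Bc that by (simp add: class_ring_simps)
  have "bij_betw (\<lambda>a. W.lincomb a B) (B \<rightarrow>\<^sub>E UNIV) C"
  proof (rule bij_betwI')
    fix a assume "a \<in> B \<rightarrow>\<^sub>E (UNIV :: 'a set)"
    show a: "W.lincomb a B \<in> C" for a using W.lincomb_closed[of B a] Bc by simp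
    fix b assume "a \<in> B \<rightarrow>\<^sub>E (UNIV :: 'a set)" "b \<in> B \<rightarrow>\<^sub>E (UNIV :: 'a set)"
    then show "W.lincomb a B = W.lincomb b B \<longleftrightarrow> a = b" using uniq[OF a] by metis
  next
    fix v assume "v \<in> C"
    then show "\<exists>a\<in>B \<rightarrow>\<^sub>E UNIV. v = W.lincomb a B" using uniq by metis
  qed
  then have "card C = card (B \<rightarrow>\<^sub>E (UNIV :: 'a set))" using bij_betw_same_card by metis
  also have "\<dots> = CARD('a) ^ card B" using B(1) by (simp add: card_PiE)
  also have "card B = code_dim n C" unfolding code_dim_def by (rule W.dim_basis[OF B, symmetric])
  finally show ?thesis .
qed

text \<open>Choose an inclusion-minimal subset \<open>K\<close> of \<open>J\<close> on which
  vanishing forces vanishing on \<open>T\<close>. Dropping \<open>j\<close> destroys this, so some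
  codeword vanishes on \<open>K - {j}\<close> but not on \<open>T\<close>; its entry at
  \<open>j\<close> cannot be zero, and scaling that entry to 1 gives the dual word
  \<open>w j\<close>.\<close>

lemma minimal_determining_set:
  fixes C :: "'a::field vec set"
  assumes C: "C \<subseteq> carrier_vec n" and smult: "\<And>a c. c \<in> C \<Longrightarrow> a \<cdot>\<^sub>v c \<in> C"
    and J: "J \<subseteq> {..<n}"
    and det: "\<And>c. c \<in> C \<Longrightarrow> \<forall>j\<in>J. c $ j = 0 \<Longrightarrow> \<forall>t\<in>T. c $ t = 0"
  obtains J' w where "J' \<subseteq> J" "\<forall>j\<in>J'. w j \<in> C"
    "\<forall>j\<in>J'. \<forall>l\<in>J'. w j $ l = (if l = j then 1 else 0)"
    "\<forall>c\<in>C. (\<forall>j\<in>J'. c $ j = 0) \<longrightarrow> (\<forall>t\<in>T. c $ t = 0)"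
proof -
  define P where "P K \<longleftrightarrow> (\<forall>c\<in>C. (\<forall>j\<in>K. c $ j = 0) \<longrightarrow> (\<forall>t\<in>T. c $ t = 0))" for K
  have "finite {K. K \<subseteq> J \<and> P K}" using J finite_subset[of J] by auto
  moreover have "J \<in> {K. K \<subseteq> J \<and> P K}" using det by (auto simp: P_def)
  ultimately obtain K where K: "K \<in> {K. K \<subseteq> J \<and> P K}"
    and min: "\<forall>K'\<in>{K. K \<subseteq> J \<and> P K}. K' \<subseteq> K \<longrightarrow> K = K'"
    using finite_has_minimal2[of "{K. K \<subseteq> J \<and> P K}" J] by blast
  have K: "K \<subseteq> J" "P K" using K by auto
  have "\<exists>v\<in>C. \<forall>l\<in>K. v $ l = (if l = j then 1 else 0)" if j: "j \<in> K" for j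
  proof -
    have "\<not> P (K - {j})" using min K(1) j by blast
    then obtain c where c: "c \<in> C" "\<forall>l\<in>K - {j}. c $ l = 0" "\<not> (\<forall>t\<in>T. c $ t = 0)"
      unfolding P_def by blast
    have cj: "c $ j \<noteq> 0" using c K(2) unfolding P_def by blast
    have "(inverse (c $ j) \<cdot>\<^sub>v c) $ l = (if l = j then 1 else 0)" if l: "l \<in> K" for l
    proof -
      have "c \<in> carrier_vec n" "l < n" using l K(1) J C c(1) by auto
      then show ?thesis using c(2) l cj by simp
    qed
    then show ?thesis using smult[OF c(1)] by blast
  qed
  then obtain w where w: "\<And>j. j \<in> K \<Longrightarrow> w j \<in> C \<and> (\<forall>l\<in>K. w j $ l = (if l = j then 1 else 0))"
    by metis
  show thesis
    by (rule that[of K w]) (use K w in \<open>auto simp: P_def\<close>)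
qed

text \<open>The bound says that \<open>J\<close> has at most as many elements as the dimension of
  \<open>X + Z\<close>, witnessed by the dual words in that sum. It is stated additively to avoid
  truncated subtraction and proved by counting pairs.\<close>

lemma punctured_information_set:
  fixes X Z :: "'a::finite_field vec set"
  assumes X: "vec_subspace n X" and Z: "vec_subspace n Z"
  obtains J where "J \<subseteq> {..<n} - {i}" "card J + code_dim n (X \<inter> Z) \<le> code_dim n X + code_dim n Z"
    "\<And>x z t. x \<in> X \<Longrightarrow> z \<in> Z \<Longrightarrow> \<forall>j\<in>J. (x + z) $ j = 0 \<Longrightarrow> t < n \<Longrightarrow> t \<noteq> i \<Longrightarrow> (x + z) $ t = 0"
proof -
  note XD = vec_subspaceD[OF X] and ZD = vec_subspaceD[OF Z]
  define C where "C = {x + z | x z. x \<in> X \<and> z \<in> Z}"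
  have C: "C \<subseteq> carrier_vec n" 
    unfolding C_def using XD(1) ZD(1) by (auto simp: subset_iff intro: add_carrier_vec)
  have smult: "a \<cdot>\<^sub>v c \<in> C" if c: "c \<in> C" for a c
  proof -
    obtain x z where xz: "c = x + z" "x \<in> X" "z \<in> Z" using c by (auto simp: C_def)
    have "a \<cdot>\<^sub>v c = a \<cdot>\<^sub>v x + a \<cdot>\<^sub>v z"
      unfolding xz(1) using XD(1) ZD(1) xz by (intro smult_add_distrib_vec) auto
    moreover have "a \<cdot>\<^sub>v x \<in> X" "a \<cdot>\<^sub>v z \<in> Z" using XD(4) ZD(4) xz by auto
    ultimately show ?thesis unfolding C_def by blast
  qed
  obtain J w where J: "J \<subseteq> {..<n} - {i}" and w: "\<forall>j\<in>J. w j \<in> C"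
    and dual: "\<forall>j\<in>J. \<forall>l\<in>J. w j $ l = (if l = j then 1 else 0)"
    and det: "\<forall>c\<in>C. (\<forall>j\<in>J. c $ j = 0) \<longrightarrow> (\<forall>t\<in>{..<n} - {i}. c $ t = 0)"
    using minimal_determining_set[OF C smult, of "{..<n} - {i}" "{..<n} - {i}"] by blast
  have finJ: "finite J" using J finite_subset by auto
  obtain wx wz where wxz: "\<And>j. j \<in> J \<Longrightarrow> wx j \<in> X \<and> wz j \<in> Z \<and> w j = wx j + wz j"
    using w unfolding C_def by (simp add: set_eq_iff) metis
  \<comment> \<open>The sum of the two components recovers \<open>a\<close> on \<open>J\<close>, so \<open>f\<close> is injective and counting gives the
    dimension bound.\<close>
  define f where "f = (\<lambda>(a, c). (vec n (\<lambda>t. \<Sum>j\<in>J. a j * wx j $ t) + c,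
                                   vec n (\<lambda>t. \<Sum>j\<in>J. a j * wz j $ t) + (-1) \<cdot>\<^sub>v c))"
  let ?D = "(J \<rightarrow>\<^sub>E (UNIV :: 'a set)) \<times> (X \<inter> Z)"
  have finXZ: "finite X" "finite Z"
    using finite_subset[OF XD(1) finite_carrier_vec] finite_subset[OF ZD(1) finite_carrier_vec] .
  have coord: "(fst (f (a, c)) + snd (f (a, c))) $ l = a l" if "c \<in> X \<inter> Z" "l \<in> J" for a c l
  proof -
    have cl: "c \<in> carrier_vec n" "l < n" using that XD(1) J by auto
    have "(fst (f (a, c)) + snd (f (a, c))) $ l = (\<Sum>j\<in>J. a j * wx j $ l) + (\<Sum>j\<in>J. a j * wz j $ l)"
      using cl by (simp add: f_def)
    also have "\<dots> = (\<Sum>j\<in>J. a j * w j $ l)"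
      unfolding sum.distrib[symmetric]
    proof (rule sum.cong[OF refl])
      fix j assume j: "j \<in> J"
      then have "wx j \<in> carrier_vec n" "wz j \<in> carrier_vec n" "w j = wx j + wz j"
        using wxz[OF j] XD(1) ZD(1) by auto
      then show "a j * wx j $ l + a j * wz j $ l = a j * w j $ l"
        using cl by (simp add: distrib_left)
    qed
    also have "\<dots> = (\<Sum>j\<in>J. if j = l then a j else 0)"
      using that by (intro sum.cong refl) (auto simp: dual)
    also have "\<dots> = a l" using that finJ by simp
    finally show ?thesis .
  qed
  have "inj_on f ?D"
  proof (rule inj_onI, clarify)
    fix a b c d assume A: "a \<in> J \<rightarrow>\<^sub>E (UNIV :: 'a set)" "b \<in> J \<rightarrow>\<^sub>E (UNIV :: 'a set)"
      and cd: "c \<in> X" "c \<in> Z" "d \<in> X" "d \<in> Z" and e: "f (a, c) = f (b, d)"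
    have ab: "a = b"
    proof (rule PiE_ext[OF A])
      fix l assume "l \<in> J"
      then show "a l = b l" using coord[of c l a] coord[of d l b] cd e by simp
    qed
    have carr: "c \<in> carrier_vec n" "d \<in> carrier_vec n" using cd XD(1) by auto
    have "c = d"
    proof (rule eq_vecI)
      show "dim_vec c = dim_vec d" using carr by simp
      fix t assume "t < dim_vec d"
      then have t: "t < n" using carr by simp
      have "fst (f (a, c)) $ t = fst (f (b, d)) $ t" using e by simp
      then show "c $ t = d $ t" using t carr ab by (simp add: f_def)
    qed
    with ab show "a = b \<and> c = d" by simp
  qed
  moreover have "f ` ?D \<subseteq> X \<times> Z"
    using vec_subspace_sum[OF X finJ, of wx] vec_subspace_sum[OF Z finJ, of wz] wxz XD(3,4) ZD(3,4)
    by (auto simp: f_def)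
  ultimately have "card ?D \<le> card (X \<times> Z)"
    using finXZ by (intro card_inj_on_le) auto
  then have "CARD('a) ^ (card J + code_dim n (X \<inter> Z)) \<le> CARD('a) ^ (code_dim n X + code_dim n Z)"
    using finJ by (simp add: card_cartesian_product card_PiE power_add
        card_vec_subspace[OF X] card_vec_subspace[OF Z] card_vec_subspace[OF vec_subspace_inter[OF X Z]])
  moreover have "CARD('a) > 1"
    using card_mono[of "UNIV" "{0, 1 :: 'a}"] by simp
  ultimately have "card J + code_dim n (X \<inter> Z) \<le> code_dim n X + code_dim n Z"
    by (rule power_le_imp_le_exp[rotated])
  moreover have "(x + z) $ t = 0" if "x \<in> X" "z \<in> Z" "\<forall>j\<in>J. (x + z) $ j = 0" "t < n" "t \<noteq> i" for x z t
    
  proof -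
    have "x + z \<in> C" using that by (auto simp: C_def)
    then show ?thesis using det that by blast
  qed
  ultimately show thesis using J that by blast
qed

text \<open>A codeword \<open>c\<close> and its interpolation \<open>s\<close> from the entries on
  \<open>K\<close> agree there, so they agree at \<open>i\<close>. This expresses
  \<open>c $ i\<close> linearly through the entries on \<open>K\<close>, and the coefficients of
  that relation form \<open>h\<close>.\<close>

lemma dual_word_supported_on:
  fixes C :: "'a::field vec set"
  assumes C: "vec_subspace n C" and i: "i < n" and J: "J \<subseteq> {..<n} - {i}"
    and det: "\<And>c. c \<in> C \<Longrightarrow> \<forall>j\<in>J. c $ j = 0 \<Longrightarrow> c $ i = 0"
  obtains h where "h \<in> dual_code n C" "i \<in> supp h" "supp h \<subseteq> insert i J"
proof -
  note D = vec_subspaceD[OF C]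
  have Jn: "J \<subseteq> {..<n}" using J by auto
  have deti: "\<forall>t\<in>{i}. c $ t = 0" if "c \<in> C" "\<forall>j\<in>J. c $ j = 0" for c
    using det[OF that] by simp
  obtain K w where K: "K \<subseteq> J" and w: "\<forall>j\<in>K. w j \<in> C"
    and dual: "\<forall>j\<in>K. \<forall>l\<in>K. w j $ l = (if l = j then 1 else 0)"
    and det': "\<forall>c\<in>C. (\<forall>j\<in>K. c $ j = 0) \<longrightarrow> (\<forall>t\<in>{i}. c $ t = 0)"
    by (rule minimal_determining_set[OF D(1) D(4) Jn deti])
  have Kn: "K \<subseteq> {..<n}" "i \<notin> K" using K J by auto
  have finK: "finite K" using Kn(1) finite_subset by auto
  define h where "h = vec n (\<lambda>t. if t = i then 1 else if t \<in> K then - w t $ i else 0)"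
  have "c \<bullet> h = 0" if c: "c \<in> C" for c
  proof -
    define s where "s = vec n (\<lambda>t. \<Sum>j\<in>K. c $ j * w j $ t)"
    have s: "s \<in> C" unfolding s_def using w by (intro vec_subspace_sum[OF C finK]) blast
    have carr: "c \<in> carrier_vec n" "s \<in> carrier_vec n" using c s D(1) by auto
    have "s $ l = c $ l" if "l \<in> K" for l
    proof -
      have "s $ l = (\<Sum>j\<in>K. c $ j * w j $ l)" using that Kn by (auto simp: s_def)
      also have "\<dots> = (\<Sum>j\<in>K. if j = l then c $ j else 0)"
        using that by (intro sum.cong) (auto simp: dual)
      finally have "s $ l = (\<Sum>j\<in>K. if j = l then c $ j else 0)" .
      then show ?thesis using that finK by simp
    qed
    then have "\<forall>l\<in>K. (c + (-1) \<cdot>\<^sub>v s) $ l = 0" using carr Kn by (auto simp: subset_eq)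
    then have "(c + (-1) \<cdot>\<^sub>v s) $ i = 0" using det' D(3)[OF c D(4)[OF s]] by blast
    then have ci: "c $ i = (\<Sum>j\<in>K. c $ j * w j $ i)" using carr i by (simp add: s_def)
    have "c \<bullet> h = (\<Sum>t\<in>insert i K. c $ t * h $ t)"
      unfolding scalar_prod_def using i Kn by (intro sum.mono_neutral_cong_right) (auto simp: h_def)
    also have "\<dots> = c $ i * h $ i + (\<Sum>t\<in>K. c $ t * h $ t)" using finK Kn by simp
    also have "(\<Sum>t\<in>K. c $ t * h $ t) = (\<Sum>t\<in>K. - (c $ t * w t $ i))"
      using Kn by (intro sum.cong) (auto simp: h_def)
    finally show ?thesis using i ci by (simp add: h_def sum_negf)
  qed
  then have "h \<in> dual_code n C" by (auto simp: dual_code_def h_def)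
  moreover have "i \<in> supp h" "supp h \<subseteq> insert i J" using i K by (auto simp: supp_def h_def split: if_splits)
  ultimately show thesis by (rule that)
qed

text \<open>Otherwise the word would have distance at most 1 from the zero word.\<close>

lemma single_coordinate_codeword_zero:
  fixes C :: "'a::field vec set"
  assumes C: "vec_subspace n C" and d: "min_distance C \<ge> 2" and c: "c \<in> C"
    and zero: "\<And>t. t < n \<Longrightarrow> t \<noteq> i \<Longrightarrow> c $ t = 0"
  shows "c = 0\<^sub>v n"
proof (rule ccontr)
  assume ne: "c \<noteq> 0\<^sub>v n"
  have cn: "c \<in> carrier_vec n" using c vec_subspaceD(1)[OF C] by auto
  have "min_distance C \<le> enat (hamming_dist c (0\<^sub>v n))"
    unfolding min_distance_def using c ne vec_subspaceD(2)[OF C] by (intro INF_lower2[of "(c, 0\<^sub>v n)"]) auto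
  moreover have "{t. t < dim_vec c \<and> c $ t \<noteq> 0\<^sub>v n $ t} \<subseteq> {i}"
  proof clarify
    fix t assume "t < dim_vec c" "c $ t \<noteq> 0\<^sub>v n $ t"
    then show "t = i" using cn zero[of t] by (cases "t = i") auto
  qed
  then have "hamming_dist c (0\<^sub>v n) \<le> 1" unfolding hamming_dist_def using card_mono[of "{i}"] by fastforce
  ultimately have "2 \<le> enat 1" using d by (meson enat_ord_simps(1) order_trans)
  then show False by (simp add: numeral_eq_enat)
qed

text \<open>One set \<open>J\<close> serves both codes because each lies in
  \<open>C_X + C_Z\<close>: take the other summand to be zero. The distance hypotheses extend the
  vanishing off \<open>i\<close> to coordinate \<open>i\<close> itself, so that both dual words can
  be supported on \<open>insert i J\<close>.\<close>

lemma local_check_words: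
  fixes C_X C_Z :: "'a::finite_field vec set"
  assumes X: "linear_code n k_X d_X C_X" and Z: "linear_code n k_Z d_Z C_Z"
    and d: "d_X \<ge> 2" "d_Z \<ge> 2" and i: "i < n"
  obtains h_X h_Z where "h_X \<in> dual_code n C_X" "h_Z \<in> dual_code n C_Z" "i \<in> supp h_X" "i \<in> supp h_Z"
    "card (supp h_X \<union> supp h_Z - {i}) \<le> n - 1"
    "card (supp h_X \<union> supp h_Z - {i}) + code_dim n (C_X \<inter> C_Z) \<le> k_X + k_Z"
proof -
  have XS: "vec_subspace n C_X" "code_dim n C_X = k_X" "min_distance C_X \<ge> 2"
    and ZS: "vec_subspace n C_Z" "code_dim n C_Z = k_Z" "min_distance C_Z \<ge> 2"
    using X Z d by (auto simp: linear_code_def)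
  obtain J where J: "J \<subseteq> {..<n} - {i}" "card J + code_dim n (C_X \<inter> C_Z) \<le> k_X + k_Z"
    and det: "\<And>x z t. x \<in> C_X \<Longrightarrow> z \<in> C_Z \<Longrightarrow> \<forall>j\<in>J. (x + z) $ j = 0 \<Longrightarrow> t < n \<Longrightarrow> t \<noteq> i \<Longrightarrow> (x + z) $ t = 0"
    using punctured_information_set[OF XS(1) ZS(1), of i] XS(2) ZS(2) by metis
  have "x $ i = 0" if "x \<in> C_X" "\<forall>j\<in>J. x $ j = 0" for x
  proof -
    have "x \<in> carrier_vec n" using that vec_subspaceD(1)[OF XS(1)] by auto
    then have "x $ t = 0" if "t < n" "t \<noteq> i" for t
      using det[OF \<open>x \<in> C_X\<close> vec_subspaceD(2)[OF ZS(1)]] \<open>\<forall>j\<in>J. x $ j = 0\<close> that by simp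
    then show ?thesis using single_coordinate_codeword_zero[OF XS(1,3) that(1), of i] i by simp
  qed
  then obtain h_X where hX: "h_X \<in> dual_code n C_X" "i \<in> supp h_X" "supp h_X \<subseteq> insert i J"
    using dual_word_supported_on[OF XS(1) i J(1)] by blast
  have "z $ i = 0" if "z \<in> C_Z" "\<forall>j\<in>J. z $ j = 0" for z
  proof -
    have "z \<in> carrier_vec n" using that vec_subspaceD(1)[OF ZS(1)] by auto
    then have "z $ t = 0" if "t < n" "t \<noteq> i" for t
      using det[OF vec_subspaceD(2)[OF XS(1)] \<open>z \<in> C_Z\<close>] \<open>\<forall>j\<in>J. z $ j = 0\<close> that by simp
    then show ?thesis using single_coordinate_codeword_zero[OF ZS(1,3) that(1), of i] i by simp
  qed
  then obtain h_Z where hZ: "h_Z \<in> dual_code n C_Z" "i \<in> supp h_Z" "supp h_Z \<subseteq> insert i J"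
    using dual_word_supported_on[OF ZS(1) i J(1)] by blast
  have finJ: "finite J" using J(1) finite_subset by auto
  have le: "card (supp h_X \<union> supp h_Z - {i}) \<le> card J"
    using finJ hX(3) hZ(3) by (intro card_mono) auto
  moreover have "card J \<le> n - 1" using card_mono[OF _ J(1)] i by simp
  ultimately show thesis using that hX hZ J(2) by (meson add_le_mono1 order_trans)
qed

section \<open>Recovery channels\<close>

lemma sum_pullback:
  fixes h :: "'p \<Rightarrow> complex" and w :: "'j \<Rightarrow> complex"
  assumes "finite P" "finite J" "f ` P \<subseteq> J"
  shows "(\<Sum>p\<in>P. h p * w (f p)) = (\<Sum>a\<in>J. (\<Sum>p\<in>{p\<in>P. f p = a}. h p) * w a)"
proof -
  have "(\<Sum>p\<in>P. h p * w (f p)) = (\<Sum>a\<in>J. \<Sum>p\<in>{p\<in>P. f p = a}. h p * w (f p))"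
    by (rule sum.group[OF assms, symmetric])
  also have "\<dots> = (\<Sum>a\<in>J. (\<Sum>p\<in>{p\<in>P. f p = a}. h p) * w a)"
    by (intro sum.cong refl) (simp add: sum_distrib_right)
  finally show ?thesis .
qed

text \<open>Grouping by fibres of \<open>f\<close> pushes the vector forward to \<open>J\<close>.
  Thus pulling back an operator along any map, injective or not, preserves positivity.\<close>

lemma quadratic_form_pullback:
  fixes \<psi> :: "'p \<Rightarrow> complex"
  assumes "finite P" "finite J" "f ` P \<subseteq> J"
  defines "\<phi> \<equiv> \<lambda>a. \<Sum>p\<in>{p\<in>P. f p = a}. \<psi> p"
  shows "(\<Sum>p\<in>P. \<Sum>q\<in>P. cnj (\<psi> p) * M (f p) (f q) * \<psi> q)
       = (\<Sum>a\<in>J. \<Sum>b\<in>J. cnj (\<phi> a) * M a b * \<phi> b)"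
proof -
  have "(\<Sum>p\<in>P. \<Sum>q\<in>P. cnj (\<psi> p) * M (f p) (f q) * \<psi> q)
      = (\<Sum>p\<in>P. cnj (\<psi> p) * (\<Sum>q\<in>P. \<psi> q * M (f p) (f q)))"
    by (simp add: sum_distrib_left mult_ac)
  also have "\<dots> = (\<Sum>p\<in>P. cnj (\<psi> p) * (\<Sum>b\<in>J. \<phi> b * M (f p) b))"
    unfolding \<phi>_def by (subst sum_pullback[OF assms(1-3), of \<psi>]) (rule refl)
  also have "\<dots> = (\<Sum>a\<in>J. cnj (\<phi> a) * (\<Sum>b\<in>J. \<phi> b * M a b))"
    unfolding \<phi>_def cnj_sum
    by (rule sum_pullback[OF assms(1-3), of "\<lambda>p. cnj (\<psi> p)"
        "\<lambda>a. \<Sum>b\<in>J. sum \<psi> {p \<in> P. f p = b} * M a b"])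
  finally show ?thesis by (simp add: sum_distrib_left mult_ac)
qed

text \<open>The channel with Kraus operators \<open>\<Sum>x\<in>L. sqrt r |x\<rangle>\<langle>m k x|\<close> for \<open>k \<in> K\<close>.\<close>

definition relabel_channel ::
    "'i set \<Rightarrow> 'i set \<Rightarrow> 'k set \<Rightarrow> ('k \<Rightarrow> 'i \<Rightarrow> 'i) \<Rightarrow> real \<Rightarrow> 'i oper \<Rightarrow> 'i oper" where
  "relabel_channel I L K m r M = restrict_oper I
     (\<lambda>x y. if x \<in> L \<and> y \<in> L then of_real r * (\<Sum>k\<in>K. M (m k x) (m k y)) else 0)"

lemma linear_relabel_channel: "linear_on_opers I (relabel_channel I L K m r)"
  unfolding linear_on_opers_def relabel_channel_def
  by (auto simp: opers_def restrict_oper_def fun_eq_iff sum.distrib distrib_left sum_distrib_left mult_ac)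

lemma Re_of_real_mult: "Re (of_real r * z) = r * Re z" by simp

text \<open>The ancilla index is untouched, so each \<open>k\<close> contributes the quadratic form
  of \<open>M\<close> at a pushed-forward vector, and \<open>r\<close> is a nonnegative
  weight.\<close>

lemma completely_positive_relabel_channel:
  assumes I: "finite I" and L: "L \<subseteq> I" and K: "finite K" and r: "r \<ge> 0"
    and m: "\<And>k x. k \<in> K \<Longrightarrow> x \<in> L \<Longrightarrow> m k x \<in> I"
  shows "completely_positive I (relabel_channel I L K m r)"
  unfolding completely_positive_def
proof (intro allI impI)
  fix d and M :: "('a \<times> nat) oper"
  assume M: "positive_oper (I \<times> {..<d}) M"
  let ?J = "I \<times> {..<d}" and ?P = "L \<times> {..<d}"
  let ?N = "amplify I d (relabel_channel I L K m r) M"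
  let ?f = "\<lambda>k (x, e). (m k x, e)"
  have finL: "finite L" using L I by (rule finite_subset)
  have N: "?N p q = (if p \<in> ?P \<and> q \<in> ?P then of_real r * (\<Sum>k\<in>K. M (?f k p) (?f k q)) else 0)"
    if "p \<in> ?J" "q \<in> ?J" for p q
  proof -
    obtain x e y f where pq: "p = (x, e)" "q = (y, f)" by (metis surj_pair)
    show ?thesis using that m unfolding pq
      by (cases "x \<in> L \<and> y \<in> L")
        (auto simp: amplify_def relabel_channel_def restrict_oper_def intro!: sum.cong)
  qed
  show "positive_oper ?J ?N"
    unfolding positive_oper_def
  proof (intro conjI allI)
    show "?N \<in> opers ?J" by (auto simp: amplify_def restrict_oper_def opers_def)
  next
    fix \<psi> :: "'a \<times> nat \<Rightarrow> complex"
    let ?S = "\<lambda>J M \<psi>. \<Sum>x\<in>J. \<Sum>y\<in>J. cnj (\<psi> x) * M x y * \<psi> (y :: 'a \<times> nat)"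
    have PJ: "?P \<subseteq> ?J" using L by auto
    have "?S ?J ?N \<psi> = (\<Sum>p\<in>?J. \<Sum>q\<in>?J. if p \<in> ?P \<and> q \<in> ?P then cnj (\<psi> p) * (of_real r * (\<Sum>k\<in>K. M (?f k p) (?f k q))) * \<psi> q else 0)"
      by (intro sum.cong refl) (simp add: N)
    also have "\<dots> = (\<Sum>p\<in>?P. \<Sum>q\<in>?P. cnj (\<psi> p) * (of_real r * (\<Sum>k\<in>K. M (?f k p) (?f k q))) * \<psi> q)"
      using PJ I by (intro sum.mono_neutral_cong_right) auto
    also have "\<dots> = of_real r * (\<Sum>k\<in>K. \<Sum>p\<in>?P. \<Sum>q\<in>?P. cnj (\<psi> p) * M (?f k p) (?f k q) * \<psi> q)"
      by (simp add: sum_distrib_left sum_distrib_right mult_ac sum.swap[of _ _ K])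
    also have "(\<Sum>k\<in>K. \<Sum>p\<in>?P. \<Sum>q\<in>?P. cnj (\<psi> p) * M (?f k p) (?f k q) * \<psi> q)
       = (\<Sum>k\<in>K. ?S ?J M (\<lambda>a. \<Sum>p\<in>{p\<in>?P. ?f k p = a}. \<psi> p))"
      using m by (intro sum.cong refl quadratic_form_pullback) (auto simp: I finL)
    finally have eq: "?S ?J ?N \<psi> = of_real r * (\<Sum>k\<in>K. ?S ?J M (\<lambda>a. \<Sum>p\<in>{p\<in>?P. ?f k p = a}. \<psi> p))" .
    have pos: "?S ?J M \<phi> \<in> \<real>" "0 \<le> Re (?S ?J M \<phi>)" for \<phi>
      using M unfolding positive_oper_def by blast+
    show "?S ?J ?N \<psi> \<in> \<real>" unfolding eq by (intro Reals_mult sum_in_Reals pos) auto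
    have "0 \<le> r * Re (\<Sum>k\<in>K. ?S ?J M (\<lambda>a. \<Sum>p\<in>{p\<in>?P. ?f k p = a}. \<psi> p))"
      using r by (intro mult_nonneg_nonneg) (auto simp only: Re_sum[of _ K] intro!: sum_nonneg pos)
    then show "0 \<le> Re (?S ?J ?N \<psi>)" unfolding eq by (simp only: Re_of_real_mult)
  qed
qed

text \<open>For the Kraus operators A_k of the channel, the sum of the products of adjoint(A_k) with
  A_k is diagonal, and its entry at \<open>z\<close> is \<open>r\<close> times the number of pairs
  \<open>(k, x)\<close> with \<open>m k x = z\<close>. The fiber hypothesis makes this the
  identity.\<close>

lemma trace_preserving_relabel_channel:
  fixes r :: real
  assumes I: "finite I" and L: "L \<subseteq> I" and K: "finite K"
    and m: "\<And>k x. k \<in> K \<Longrightarrow> x \<in> L \<Longrightarrow> m k x \<in> I"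
    and fiber: "\<And>z. z \<in> I \<Longrightarrow> r * card {(k, x). k \<in> K \<and> x \<in> L \<and> m k x = z} = 1"
  shows "trace_preserving I (relabel_channel I L K m r)"
  unfolding trace_preserving_def
proof
  fix M assume "M \<in> opers I"
  have finL: "finite L" using L I by (rule finite_subset)
  have "oper_trace I (relabel_channel I L K m r M) = (\<Sum>x\<in>L. of_real r * (\<Sum>k\<in>K. M (m k x) (m k x)))"
    unfolding oper_trace_def relabel_channel_def restrict_oper_def using I L
    by (intro sum.mono_neutral_cong_right) auto
  also have "\<dots> = of_real r * (\<Sum>k\<in>K. \<Sum>x\<in>L. M (m k x) (m k x))"
    by (simp add: sum_distrib_left sum.swap[of _ K])
  also have "(\<Sum>k\<in>K. \<Sum>x\<in>L. M (m k x) (m k x)) = (\<Sum>p\<in>K \<times> L. 1 * (\<lambda>z. M z z) ((\<lambda>(k, x). m k x) p))"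
    by (simp add: sum.cartesian_product case_prod_unfold)
  also have "\<dots> = (\<Sum>z\<in>I. (\<Sum>p\<in>{p\<in>K \<times> L. (\<lambda>(k, x). m k x) p = z}. 1) * M z z)"
    using m by (intro sum_pullback) (auto simp: I K finL)
  also have "of_real r * \<dots> = (\<Sum>z\<in>I. of_real (r * card {(k, x). k \<in> K \<and> x \<in> L \<and> m k x = z}) * M z z)"
    unfolding sum_distrib_left
    by (intro sum.cong refl) (auto simp: case_prod_unfold mem_Times_iff conj_assoc)
  also have "\<dots> = (\<Sum>z\<in>I. M z z)" by (intro sum.cong refl) (simp only: fiber of_real_1 mult_1)
  finally show "oper_trace I (relabel_channel I L K m r M) = oper_trace I M"
    by (simp add: oper_trace_def)
qed

section \<open>Recovery from one linear constraint and one translation symmetry\<close>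

lemma finite_configs: "finite A \<Longrightarrow> finite (configs A :: ('a::finite) config set)"
  unfolding configs_def by (rule finite_PiE) auto

lemma configs_iff: "x \<in> configs A \<longleftrightarrow> (\<forall>z. z \<notin> A \<longrightarrow> x z = undefined)"
  by (auto simp: configs_def PiE_def extensional_def)

lemma erasure_ketbra:
  fixes \<psi> :: "('a::finite) config ket"
  assumes "i \<in> N" "x \<in> configs N" "y \<in> configs N"
  shows "erasure N i (ketbra \<psi>) x y
       = (if x i = y i then 1 / of_nat CARD('a) else 0) * (\<Sum>a\<in>UNIV. \<psi> (x(i := a)) * cnj (\<psi> (y(i := a))))"
proof -
  have N: "{i} \<union> (N - {i}) = N" using assms(1) by auto
  have r: "(restrict z (N - {i}))(i := a) = z(i := a)" if "z \<in> configs N" for z :: "'a config" and a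
    using that by (auto simp: configs_iff fun_eq_iff)
  have e: "restrict x {i} = restrict y {i} \<longleftrightarrow> x i = y i" by (auto simp: fun_eq_iff)
  have c: "restrict z B \<in> configs B" for z :: "'a config" and B by (simp add: configs_iff)
  show ?thesis
    unfolding erasure_def oper_tensor_def N restrict_oper_def maximally_mixed_def
      partial_trace_def ketbra_def
    by (simp only: assms(2,3) c e simp_thms if_True r)
qed

text \<open>The form \<open>l\<close> describes the support of the code states and \<open>g\<close>
  a direction in which they are invariant. The condition \<open>lg\<close> makes translation along
  \<open>g\<close> respect the constraint, \<open>li\<close> lets the constraint determine the lost
  value, and \<open>gi\<close> lets a translation reach any prescribed value at
  \<open>i\<close>.\<close>

lemma recovery_channel:
  fixes g l :: "qudit \<Rightarrow> 'a::finite_field" and \<C> :: "'a config ket set"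
  assumes N: "finite N" and AN: "A \<subseteq> N" and iA: "i \<in> A"
    and gi: "g i = 1" and li: "l i \<noteq> 0" and lg: "(\<Sum>z\<in>A. l z * g z) = 0"
    and kets: "\<And>\<psi>. \<psi> \<in> \<C> \<Longrightarrow> \<psi> \<in> kets (configs N)"
    and supp: "\<And>\<psi> x. \<psi> \<in> \<C> \<Longrightarrow> x \<in> configs N \<Longrightarrow> \<psi> x \<noteq> 0 \<Longrightarrow> (\<Sum>z\<in>A. l z * x z) = 0"
    and inv: "\<And>\<psi> x s. \<psi> \<in> \<C> \<Longrightarrow> x \<in> configs N \<Longrightarrow>
                \<psi> (\<lambda>z. if z \<in> A then x z + s * g z else x z) = \<psi> x"
  obtains Rec where "quantum_channel (configs A) Rec"
    and "\<forall>\<psi>\<in>\<C>. channel_tensor_id A Rec (N - A) (erasure N i (ketbra \<psi>)) = ketbra \<psi>"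
proof -
  have finA: "finite A" using AN N by (rule finite_subset)
  define ell where "ell = (\<lambda>x. \<Sum>z\<in>A. l z * x z)"
  define sh where "sh = (\<lambda>s (x::'a config) z. if z \<in> A then x z + s * g z else x z)"
  \<comment> \<open>\<open>t\<close> is the value found in the erased qudit, \<open>s\<close> the value it originally had.\<close>
  define m where "m = (\<lambda>(s, t) x. (sh (s - x i) x)(i := t))"
  define L where "L = {x \<in> configs A. ell x = 0}"
  \<comment> \<open>The weight is 1/q because every configuration of \<open>A\<close> arises as
    \<open>m k x\<close> from exactly q pairs, as \<open>fiber\<close> shows.\<close>
  define Rec where "Rec = relabel_channel (configs A) L (UNIV :: ('a \<times> 'a) set) m (1 / CARD('a))"
  have ell_sh: "ell (sh s x) = ell x" for s x
  proof -
    have "ell (sh s x) = (\<Sum>z\<in>A. l z * x z + s * (l z * g z))"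
      unfolding ell_def sh_def by (intro sum.cong) (auto simp: algebra_simps)
    also have "\<dots> = ell x" by (simp add: sum.distrib ell_def lg flip: sum_distrib_left)
    finally show ?thesis .
  qed
  have ell_upd: "ell (x(i := a)) = ell x + l i * (a - x i)" for x a
  proof -
    have "ell y = l i * y i + (\<Sum>z\<in>A - {i}. l z * y z)" for y
      unfolding ell_def by (rule sum.remove[OF finA iA])
    from this[of x] this[of "x(i := a)"] show ?thesis by (simp add: algebra_simps)
  qed
  have sh_i: "sh s x i = x i + s" for s x using iA gi by (simp add: sh_def)
  have sh_sh: "sh s (sh t x) = sh (s + t) x" for s t x
    by (auto simp: sh_def fun_eq_iff algebra_simps)
  have sh_0: "sh 0 x = x" for x by (auto simp: sh_def fun_eq_iff)
  have sh_conf: "sh s x \<in> configs B \<longleftrightarrow> x \<in> configs B" if "A \<subseteq> B" for s B and x :: "'a config"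
  proof -
    have "sh s x z = x z" if "z \<notin> B" for z using that \<open>A \<subseteq> B\<close> by (auto simp: sh_def)
    then show ?thesis by (simp add: configs_iff)
  qed
  have upd_conf: "x(i := a) \<in> configs B \<longleftrightarrow> x \<in> configs B" if "A \<subseteq> B" for a B and x :: "'a config"
  proof -
    have "z \<noteq> i" if "z \<notin> B" for z using that \<open>A \<subseteq> B\<close> iA by auto
    then show ?thesis by (simp add: configs_iff)
  qed
  have fiber: "1 / CARD('a) * card {(k, x). k \<in> UNIV \<and> x \<in> L \<and> m k x = z} = 1" if z: "z \<in> configs A" for z
  proof -
    \<comment> \<open>The only value at \<open>i\<close> that brings \<open>z\<close> into the
      kernel of \<open>ell\<close>.\<close>
    define s where "s = z i - ell z / l i"
    have ell0: "ell (z(i := a)) = 0 \<longleftrightarrow> a = s" for a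
      using li by (auto simp: ell_upd s_def field_simps)
    \<comment> \<open>The pair \<open>(s, z i)\<close> is forced by \<open>z\<close>; what remains
      free is the translate of \<open>z(i := s)\<close> along \<open>g\<close>, indexed by its value
      \<open>a\<close> at \<open>i\<close>.\<close>
    define h where "h = (\<lambda>a. ((s, z i), sh (a - s) (z(i := s))))"
    have "inj h"
    proof (rule injI)
      fix a b assume "h a = h b"
      then have "sh (a - s) (z(i := s)) i = sh (b - s) (z(i := s)) i" by (simp add: h_def)
      then show "a = b" by (simp add: sh_i)
    qed
    moreover have "{(k, x). k \<in> UNIV \<and> x \<in> L \<and> m k x = z} = range h"
    proof (intro equalityI subsetI)
      fix p assume p: "p \<in> {(k, x). k \<in> UNIV \<and> x \<in> L \<and> m k x = z}"
      obtain s' t x where pe: "p = ((s', t), x)" by (metis surj_pair)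
      have x: "x \<in> configs A" "ell x = 0" and mz: "(sh (s' - x i) x)(i := t) = z"
        using p pe by (auto simp: L_def m_def)
      have t: "z i = t" using mz by auto
      have zs: "z(i := s') = sh (s' - x i) x" 
        unfolding mz[symmetric] by (auto simp: fun_eq_iff sh_i)
      then have "ell (z(i := s')) = 0" using x ell_sh by metis
      then have s': "s' = s" using ell0 by blast
      have "x = sh (x i - s') (z(i := s'))" unfolding zs by (simp add: sh_sh sh_0)
      then have "p = h (x i)" using pe s' t by (simp add: h_def)
      then show "p \<in> range h" by blast
    next
      fix p assume "p \<in> range h"
      then obtain a where p: "p = h a" by blast
      have "sh (s - a) (sh (a - s) (z(i := s))) = z(i := s)" by (simp add: sh_sh sh_0)
      then have "m (s, z i) (sh (a - s) (z(i := s))) = z" by (simp add: m_def sh_i)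
      moreover have "sh (a - s) (z(i := s)) \<in> L"
        using z ell0[of s] by (simp add: L_def ell_sh sh_conf upd_conf)
      ultimately show "p \<in> {(k, x). k \<in> UNIV \<and> x \<in> L \<and> m k x = z}" by (simp add: p h_def)
    qed
    ultimately have "card {(k, x). k \<in> UNIV \<and> x \<in> L \<and> m k x = z} = CARD('a)"
      by (simp add: card_image)
    then show ?thesis by simp
  qed
  have m_conf: "m k x \<in> configs A" if "x \<in> configs A" for k x
    using that by (cases k) (simp add: m_def sh_conf upd_conf)
  have L: "L \<subseteq> configs A" by (auto simp: L_def)
  have "completely_positive (configs A) Rec"
    unfolding Rec_def by (rule completely_positive_relabel_channel)
      (use L m_conf in \<open>auto simp: finite_configs[OF finA]\<close>)
  moreover have "trace_preserving (configs A) Rec"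
    unfolding Rec_def by (rule trace_preserving_relabel_channel[OF _ L _ _ fiber])
      (use L m_conf in \<open>auto simp: finite_configs[OF finA]\<close>)
  ultimately have "quantum_channel (configs A) Rec"
    unfolding quantum_channel_def by (simp add: Rec_def linear_relabel_channel)
  moreover have "channel_tensor_id A Rec (N - A) (erasure N i (ketbra \<psi>)) = ketbra \<psi>"
    if \<psi>: "\<psi> \<in> \<C>" for \<psi>
  proof (intro ext)
    fix x y
    let ?q = "of_nat CARD('a) :: complex"
    have AW: "A \<union> N = N" using AN by auto
    have z0: "\<psi> z = 0" if "z \<in> configs N" "ell z \<noteq> 0" for z
      using supp[OF \<psi> that(1)] that(2) by (auto simp: ell_def)
    show "channel_tensor_id A Rec (N - A) (erasure N i (ketbra \<psi>)) x y = ketbra \<psi> x y"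
    proof (cases "x \<in> configs N \<and> y \<in> configs N")
      case False
      then have "ketbra \<psi> x y = 0" using kets[OF \<psi>] by (auto simp: ketbra_def kets_def)
      then show ?thesis using False by (auto simp: channel_tensor_id_def AW restrict_oper_def)
    next
      case xy: True
      have restr: "restrict z A \<in> configs A" for z :: "'a config" by (simp add: configs_iff)
      have ell_r: "ell (restrict z A) = ell z" for z by (simp add: ell_def)
      \<comment> \<open>\<open>m k\<close> reads the qudits of \<open>A\<close> to change only
        those, so it commutes with cutting out \<open>A\<close> and putting it back.\<close>
      have ov: "override_on z (m k (restrict z A)) A = m k z" for z k
        using iA by (cases k) (auto simp: override_on_def m_def sh_def fun_eq_iff)
      have lhs: "channel_tensor_id A Rec (N - A) (erasure N i (ketbra \<psi>)) x y
        = (if ell x = 0 \<and> ell y = 0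
           then 1 / ?q * (\<Sum>k\<in>UNIV. erasure N i (ketbra \<psi>) (m k x) (m k y)) else 0)"
        using xy by (simp add: channel_tensor_id_def AW restrict_oper_def Rec_def relabel_channel_def
            restr L_def ell_r m_conf ov)
      show ?thesis
      proof (cases "ell x = 0 \<and> ell y = 0")
        case False
        then show ?thesis using lhs xy z0 by (auto simp: ketbra_def)
      next
        case True
        have m_N: "m k z \<in> configs N" if "z \<in> configs N" for k z
          using that AN by (cases k) (simp add: m_def sh_conf upd_conf)
        \<comment> \<open>In the partial trace only \<open>a = s\<close> survives: any other value
          violates \<open>ell = 0\<close>, and at \<open>a = s\<close> the configuration is a
          translate of \<open>z\<close> along \<open>g\<close>.\<close>
        have corr: "\<psi> ((m (s, t) z)(i := a)) = (if a = s then \<psi> z else 0)"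
          if z: "z \<in> configs N" "ell z = 0" for s t a z
        proof -
          have e: "(m (s, t) z)(i := a) = (sh (s - z i) z)(i := a)" by (simp add: m_def)
          show ?thesis
          proof (cases "a = s")
            case True
            then have "(m (s, t) z)(i := a) = sh (s - z i) z"
              unfolding e by (auto simp: fun_eq_iff sh_i)
            then show ?thesis using inv[OF \<psi> z(1)] True by (simp add: sh_def)
          next
            case False
            then have "ell ((sh (s - z i) z)(i := a)) \<noteq> 0"
              using li z(2) by (simp add: ell_upd ell_sh sh_i)
            then show ?thesis using False z0 AN z(1) by (simp add: e sh_conf upd_conf)
          qed
        qed
        have er: "erasure N i (ketbra \<psi>) (m k x) (m k y) = 1 / ?q * (\<psi> x * cnj (\<psi> y))" for k
        proof (cases k)
          case (Pair s t)
          have "m k x i = t" "m k y i = t" by (simp_all add: Pair m_def)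
          moreover have "(\<Sum>a\<in>UNIV. \<psi> ((m k x)(i := a)) * cnj (\<psi> ((m k y)(i := a))))
              = (\<Sum>a\<in>UNIV. if a = s then \<psi> x * cnj (\<psi> y) else 0)"
            using xy True by (intro sum.cong) (auto simp: Pair corr)
          ultimately show ?thesis using iA AN m_N xy by (subst erasure_ketbra) auto
        qed
        \<comment> \<open>All q^2 pairs contribute equally. One factor 1/q comes from the maximally
          mixed qudit, the other from the channel, and together they cancel q^2.\<close>
        have "(\<Sum>k\<in>(UNIV :: ('a \<times> 'a) set). erasure N i (ketbra \<psi>) (m k x) (m k y)) = ?q * (\<psi> x * cnj (\<psi> y))"
          by (simp add: er card_prod)
        then show ?thesis using lhs True by (simp add: ketbra_def)
      qed
    qed
  qed
  ultimately show thesis by (intro that) blast+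
qed

section \<open>Code states\<close>

lemma prod_indicator:
  "finite A \<Longrightarrow> (\<Prod>j\<in>A. if P j then 1 else 0) = (if \<forall>j\<in>A. P j then 1 else (0::'b::comm_semiring_1))"
  by (induction A rule: finite_induct) auto

lemma configs_eqI:
  assumes "x \<in> configs A" "y \<in> configs A" "\<And>z. z \<in> A \<Longrightarrow> x z = y z"
  shows "x = y"
  using assms unfolding configs_def by (rule PiE_ext)

lemma pauli_X_apply:
  "pauli_X l a y x =
     (if y \<in> configs (l ` {..<dim_vec a}) \<and> x \<in> configs (l ` {..<dim_vec a}) \<and>
         (\<forall>j<dim_vec a. y (l j) = x (l j) + a $ j) then 1 else 0)"
  by (simp add: pauli_X_def restrict_oper_def pauli_X1_def prod_indicator Ball_def)

lemma pauli_Z_apply: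
  "pauli_Z l b y x =
     (if x \<in> configs (l ` {..<dim_vec b}) \<and> y = x
      then trace_char (\<Sum>j<dim_vec b. b $ j * x (l j)) else 0)"
proof (cases "x \<in> configs (l ` {..<dim_vec b}) \<and> y \<in> configs (l ` {..<dim_vec b}) \<and> y \<noteq> x")
  case True
  then obtain j where "j < dim_vec b" "y (l j) \<noteq> x (l j)"
    using configs_eqI[of y "l ` {..<dim_vec b}" x] by blast
  then have "(\<Prod>j<dim_vec b. pauli_Z1 (b $ j) (y (l j)) (x (l j))) = 0"
    by (intro prod_zero) (auto simp: pauli_Z1_def)
  then show ?thesis using True by (simp add: pauli_Z_def restrict_oper_def)
next
  case False
  then show ?thesis
    by (auto simp: pauli_Z_def restrict_oper_def pauli_Z1_def trace_char_sum)
qed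

text \<open>The product applies Z first, so the phase is evaluated at the input \<open>x\<close> and
  not at the shifted \<open>y\<close>.\<close>

lemma pauli_XZ_apply:
  fixes a b :: "'a::finite_field vec"
  assumes "dim_vec a = d" "dim_vec b = d" "x \<in> configs (l ` {..<d})" "y \<in> configs (l ` {..<d})"
  shows "oper_mult (configs (l ` {..<d})) (pauli_X l a) (pauli_Z l b) y x =
     (if \<forall>j<d. y (l j) = x (l j) + a $ j then trace_char (\<Sum>j<d. b $ j * x (l j)) else 0)"
proof -
  have "oper_mult (configs (l ` {..<d})) (pauli_X l a) (pauli_Z l b) y x
      = (\<Sum>z\<in>configs (l ` {..<d}). if z = x then pauli_X l a y x * trace_char (\<Sum>j<d. b $ j * x (l j)) else 0)"
    unfolding oper_mult_def using assms by (intro sum.cong) (auto simp: pauli_Z_apply)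
  also have "\<dots> = pauli_X l a y x * trace_char (\<Sum>j<d. b $ j * x (l j))"
    using assms(3) finite_configs[of "l ` {..<d}", where 'a='a] by simp
  finally show ?thesis using assms by (auto simp: pauli_X_apply)
qed

lemma ea_stabilizer_apply:
  fixes H_X H_Z F_X F_Z :: "'a::finite_field mat"
  assumes dims: "dim_col H_X = n" "dim_col H_Z = n" "dim_col F_X = c" "dim_col F_Z = c"
    and xy: "x \<in> configs (reg_Q {..<n} \<union> reg_B c)" "y \<in> configs (reg_Q {..<n} \<union> reg_B c)"
  shows "ea_stabilizer H_X H_Z F_X F_Z u v y x =
     (if (\<forall>j<n. y (Q j) = x (Q j) + (H_X\<^sup>T *\<^sub>v u) $ j) \<and> (\<forall>j<c. y (B j) = x (B j) + (F_X\<^sup>T *\<^sub>v u) $ j)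
      then trace_char ((\<Sum>j<n. (H_Z\<^sup>T *\<^sub>v v) $ j * x (Q j)) + (\<Sum>j<c. (F_Z\<^sup>T *\<^sub>v v) $ j * x (B j))) else 0)"
proof -
  have r: "restrict z A \<in> configs A" for z :: "'a config" and A by (simp add: configs_iff)
  show ?thesis
    using xy
    by (auto simp: ea_stabilizer_def Let_def dims oper_tensor_def restrict_oper_def reg_Q_def reg_B_def
        pauli_XZ_apply r trace_char_add)
qed

text \<open>Each row of a stabilizer has a single nonzero entry, so the fixed-point equation at
  \<open>y\<close> involves only one other amplitude. With \<open>u = 0\<close> it restricts the
  support of \<open>\<psi>\<close>; with \<open>v = 0\<close> it gives translation
  invariance.\<close>

lemma ea_css_code_shift:
  fixes H_X H_Z F_X F_Z :: "'a::finite_field mat"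
  assumes dims: "H_X \<in> carrier_mat r_X n" "H_Z \<in> carrier_mat r_Z n"
      "F_X \<in> carrier_mat r_X c" "F_Z \<in> carrier_mat r_Z c"
    and \<psi>: "\<psi> \<in> ea_css_code H_X H_Z F_X F_Z"
    and uv: "u \<in> carrier_vec r_X" "v \<in> carrier_vec r_Z"
    and x: "x \<in> configs (reg_Q {..<n} \<union> reg_B c)" and y: "y \<in> configs (reg_Q {..<n} \<union> reg_B c)"
    and shift: "\<And>j. j < n \<Longrightarrow> y (Q j) = x (Q j) + (H_X\<^sup>T *\<^sub>v u) $ j"
      "\<And>j. j < c \<Longrightarrow> y (B j) = x (B j) + (F_X\<^sup>T *\<^sub>v u) $ j"
  shows "\<psi> y = trace_char ((\<Sum>j<n. (H_Z\<^sup>T *\<^sub>v v) $ j * x (Q j)) + (\<Sum>j<c. (F_Z\<^sup>T *\<^sub>v v) $ j * x (B j))) * \<psi> x"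
    (is "_ = ?ch * _")
proof -
  let ?I = "configs (reg_Q {..<n} \<union> reg_B c) :: 'a config set"
  let ?S = "ea_stabilizer H_X H_Z F_X F_Z u v"
  have D: "dim_col H_X = n" "dim_col H_Z = n" "dim_col F_X = c" "dim_col F_Z = c"
      "dim_row H_X = r_X" "dim_row H_Z = r_Z"
    using dims by auto
  have "oper_apply ?I ?S \<psi> = \<psi>"
    using \<psi> uv by (simp add: ea_css_code_def Let_def D)
  then have "\<psi> y = (\<Sum>z\<in>?I. ?S y z * \<psi> z)" unfolding oper_apply_def by metis
  also have "\<dots> = (\<Sum>z\<in>?I. if z = x then ?ch * \<psi> x else 0)"
  proof (rule sum.cong[OF refl])
    fix z assume z: "z \<in> ?I"
    show "?S y z * \<psi> z = (if z = x then ?ch * \<psi> x else 0)"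
    proof (cases "z = x")
      case True
      then show ?thesis using ea_stabilizer_apply[OF D(1-4) x y] shift by simp
    next
      case False
      then obtain w where w: "w \<in> reg_Q {..<n} \<union> reg_B c" "z w \<noteq> x w"
        using configs_eqI[OF z x] by blast
      have "\<not> ((\<forall>j<n. y (Q j) = z (Q j) + (H_X\<^sup>T *\<^sub>v u) $ j) \<and> (\<forall>j<c. y (B j) = z (B j) + (F_X\<^sup>T *\<^sub>v u) $ j))"
        using w shift by (auto simp: reg_Q_def reg_B_def)
      then have "?S y z = 0" unfolding ea_stabilizer_apply[OF D(1-4) z y] by (rule if_not_P)
      then show ?thesis using False by simp
    qed
  qed
  also have "\<dots> = ?ch * \<psi> x"
    using x finite_configs[of "reg_Q {..<n} \<union> reg_B c", where 'a='a] by (simp add: reg_Q_def reg_B_def)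
  finally show ?thesis .
qed

section \<open>From dual words to recovery sets\<close>

lemma row_space_iff:
  fixes H :: "'a::field mat"
  assumes "H \<in> carrier_mat r n"
  shows "h \<in> vec_space.row_space n H \<longleftrightarrow> (\<exists>u\<in>carrier_vec r. h = H\<^sup>T *\<^sub>v u)"
proof -
  have "vec_space.row_space n H = {y \<in> carrier_vec n. \<exists>x\<in>carrier_vec r. H\<^sup>T *\<^sub>v x = y}"
    using vec_space.row_space_eq[OF assms] assms by simp
  then show ?thesis using assms by auto
qed

text \<open>Both inner products are bilinear forms in \<open>u\<close> and \<open>v\<close>, with
  matrices \<open>H_X * H_Z\<^sup>T\<close> and \<open>F_X * F_Z\<^sup>T\<close>, which cancel by
  the factorization. Bob's qudits thus make the extended X-type and Z-type stabilizers
  commute.\<close>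

lemma check_words_orthogonal:
  fixes H_X H_Z F_X F_Z :: "'a::field mat"
  assumes "H_X \<in> carrier_mat r_X n" "H_Z \<in> carrier_mat r_Z n"
      "F_X \<in> carrier_mat r_X c" "F_Z \<in> carrier_mat r_Z c"
    and fact: "- (H_X * H_Z\<^sup>T) = F_X * F_Z\<^sup>T"
    and uv: "u \<in> carrier_vec r_X" "v \<in> carrier_vec r_Z"
  shows "(H_X\<^sup>T *\<^sub>v u) \<bullet> (H_Z\<^sup>T *\<^sub>v v) + (F_X\<^sup>T *\<^sub>v u) \<bullet> (F_Z\<^sup>T *\<^sub>v v) = 0"
proof -
  have move: "(A\<^sup>T *\<^sub>v u) \<bullet> (D\<^sup>T *\<^sub>v v) = u \<bullet> ((A * D\<^sup>T) *\<^sub>v v)"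
    if "A \<in> carrier_mat r_X m" "D \<in> carrier_mat r_Z m" for A D :: "'a mat" and m
  proof -
    have "(A\<^sup>T *\<^sub>v u) \<bullet> (D\<^sup>T *\<^sub>v v) = u \<bullet> (A *\<^sub>v (D\<^sup>T *\<^sub>v v))"
      using that uv by (intro transpose_vec_mult_scalar) auto
    then show ?thesis using that uv by (simp add: assoc_mult_mat_vec[of A r_X m "D\<^sup>T" r_Z v])
  qed
  have "(- M) *\<^sub>v v = - (M *\<^sub>v v)" if "M \<in> carrier_mat r_X r_Z" for M :: "'a mat"
    using that uv by (intro eq_vecI) (auto simp: uminus_scalar_prod)
  then show ?thesis using assms by (simp add: move flip: fact)
qed

lemma sum_registers:
  fixes f :: "qudit \<Rightarrow> 'b::comm_monoid_add"
  shows "(\<Sum>z\<in>reg_Q {..<n} \<union> reg_B c. f z) = (\<Sum>j<n. f (Q j)) + (\<Sum>j<c. f (B j))"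
proof -
  have "inj_on Q {..<n}" "inj_on B {..<c}" by (auto simp: inj_on_def)
  then show ?thesis unfolding reg_Q_def reg_B_def
    by (subst sum.union_disjoint) (auto simp: sum.reindex)
qed

text \<open>The X-check, extended to Bob's qudits by \<open>F_X\<close> and scaled to 1 at
  \<open>i\<close>, is the direction \<open>g\<close>; the Z-check, extended by \<open>F_Z\<close>,
  is the form \<open>l\<close>. Bob's qudits always belong to \<open>A\<close>, so the parts of the
  checks on them do not enlarge the recovery set.\<close>

lemma recovery_set_of_check_words:
  fixes C_X C_Z :: "'a::finite_field vec set" and H_X H_Z F_X F_Z :: "'a mat"
  assumes dims: "H_X \<in> carrier_mat r_X n" "H_Z \<in> carrier_mat r_Z n"
      "F_X \<in> carrier_mat r_X c" "F_Z \<in> carrier_mat r_Z c"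
    and fact: "- (H_X * H_Z\<^sup>T) = F_X * F_Z\<^sup>T"
    and i: "i < n"
    and hX: "h_X \<in> vec_space.row_space n H_X" "i \<in> supp h_X"
    and hZ: "h_Z \<in> vec_space.row_space n H_Z" "i \<in> supp h_Z"
  shows "recovery_set n c (ea_css_code H_X H_Z F_X F_Z) i (supp h_X \<union> supp h_Z - {i})"
proof -
  let ?\<C> = "ea_css_code H_X H_Z F_X F_Z" and ?R = "supp h_X \<union> supp h_Z - {i}"
  obtain u where u: "u \<in> carrier_vec r_X" "h_X = H_X\<^sup>T *\<^sub>v u"
    using hX(1) unfolding row_space_iff[OF dims(1)] by blast
  obtain v where v: "v \<in> carrier_vec r_Z" "h_Z = H_Z\<^sup>T *\<^sub>v v"
    using hZ(1) unfolding row_space_iff[OF dims(2)] by blast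
  have dim: "dim_vec h_X = n" "dim_vec h_Z = n" using dims u v by auto
  have nz: "h_X $ i \<noteq> 0" "h_Z $ i \<noteq> 0" using hX(2) hZ(2) by (auto simp: supp_def)
  have mult: "((M\<^sup>T *\<^sub>v (s \<cdot>\<^sub>v w)) $ j) = s * (M\<^sup>T *\<^sub>v w) $ j"
    if "M \<in> carrier_mat r m" "w \<in> carrier_vec r" "j < m" for M :: "'a mat" and r m s w j
    using that by (simp add: mult_mat_vec[of "M\<^sup>T" m r])
  have zero: "(M\<^sup>T *\<^sub>v 0\<^sub>v r) $ j = 0"
    if "M \<in> carrier_mat r m" "j < m" for M :: "'a mat" and r m j
    using that by simp
  define g where "g = (\<lambda>z. case z of Q j \<Rightarrow> h_X $ j / h_X $ i | B j \<Rightarrow> (F_X\<^sup>T *\<^sub>v u) $ j / h_X $ i)"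
  define l where "l = (\<lambda>z. case z of Q j \<Rightarrow> h_Z $ j | B j \<Rightarrow> (F_Z\<^sup>T *\<^sub>v v) $ j)"
  define N where "N = reg_Q {..<n} \<union> reg_B c"
  define A where "A = reg_Q ({i} \<union> ?R) \<union> reg_B c"
  have finN: "finite N" by (simp add: N_def reg_Q_def reg_B_def)
  have supp_n: "supp h_X \<subseteq> {..<n}" "supp h_Z \<subseteq> {..<n}" using dim by (auto simp: supp_def)
  have AN: "A \<subseteq> N" using i supp_n by (auto simp: A_def N_def reg_Q_def)
  have W: "N - A = reg_Q ({..<n} - ({i} \<union> ?R))"
    by (auto simp: A_def N_def reg_Q_def reg_B_def)
  \<comment> \<open>Hence sums over \<open>A\<close> are sums over all qudits, and a translation
    confined to \<open>A\<close> is a full stabilizer shift.\<close>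
  have off: "g z = 0" "l z = 0" if "z \<in> N" "z \<notin> A" for z
    using that dim i by (auto simp: A_def N_def reg_Q_def reg_B_def g_def l_def supp_def)
  have sumA: "(\<Sum>z\<in>A. l z * f z)
      = (\<Sum>j<n. (H_Z\<^sup>T *\<^sub>v v) $ j * f (Q j)) + (\<Sum>j<c. (F_Z\<^sup>T *\<^sub>v v) $ j * f (B j))" for f
  proof -
    have "(\<Sum>z\<in>A. l z * f z) = (\<Sum>z\<in>N. l z * f z)"
      using finN AN off by (intro sum.mono_neutral_left) auto
    then show ?thesis unfolding N_def sum_registers by (simp add: l_def v(2))
  qed
  have iA: "Q i \<in> A" by (simp add: A_def reg_Q_def)
  have gi: "g (Q i) = 1" and li: "l (Q i) \<noteq> 0" using nz by (simp_all add: g_def l_def)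
  have lg: "(\<Sum>z\<in>A. l z * g z) = 0"
  proof -
    have "(\<Sum>z\<in>A. l z * g z) = ((H_X\<^sup>T *\<^sub>v u) \<bullet> (H_Z\<^sup>T *\<^sub>v v) + (F_X\<^sup>T *\<^sub>v u) \<bullet> (F_Z\<^sup>T *\<^sub>v v)) / h_X $ i"
      unfolding sumA scalar_prod_def using dims dim
      by (simp add: g_def u(2) v(2) add_divide_distrib sum_divide_distrib mult.commute atLeast0LessThan)
    then show ?thesis using check_words_orthogonal[OF dims fact u(1) v(1)] by simp
  qed
  have kets: "\<psi> \<in> kets (configs N)" if "\<psi> \<in> ?\<C>" for \<psi>
    using that dims by (auto simp: ea_css_code_def Let_def N_def)
  have supp: "(\<Sum>z\<in>A. l z * x z) = 0" if \<psi>: "\<psi> \<in> ?\<C>" "x \<in> configs N" "\<psi> x \<noteq> 0" for \<psi> x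
  proof (rule trace_char_nontrivial)
    fix b
    \<comment> \<open>Scaling \<open>v\<close> by every \<open>b\<close> makes all phases
      \<open>trace_char (b * _)\<close> trivial at a configuration with nonzero amplitude, which
      forces the linear form to vanish there.\<close>
    have "\<psi> x = trace_char ((\<Sum>j<n. (H_Z\<^sup>T *\<^sub>v (b \<cdot>\<^sub>v v)) $ j * x (Q j))
        + (\<Sum>j<c. (F_Z\<^sup>T *\<^sub>v (b \<cdot>\<^sub>v v)) $ j * x (B j))) * \<psi> x"
      using \<psi>(2) v(1) zero[OF dims(1)] zero[OF dims(3)] unfolding N_def
      by (intro ea_css_code_shift[OF dims \<psi>(1), of "0\<^sub>v r_X"]) auto
    also have "(\<Sum>j<n. (H_Z\<^sup>T *\<^sub>v (b \<cdot>\<^sub>v v)) $ j * x (Q j)) + (\<Sum>j<c. (F_Z\<^sup>T *\<^sub>v (b \<cdot>\<^sub>v v)) $ j * x (B j))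
        = b * (\<Sum>z\<in>A. l z * x z)"
      unfolding sumA distrib_left sum_distrib_left
      by (simp add: mult[OF dims(2) v(1)] mult[OF dims(4) v(1)] mult.assoc)
    finally show "trace_char (b * (\<Sum>z\<in>A. l z * x z)) = 1" using \<psi>(3) by simp
  qed
  have inv: "\<psi> (\<lambda>z. if z \<in> A then x z + s * g z else x z) = \<psi> x" (is "\<psi> ?y = _")
    if \<psi>: "\<psi> \<in> ?\<C>" and x: "x \<in> configs N" for \<psi> x s
  proof -
    \<comment> \<open>Chosen so that the stabilizer shift equals \<open>s\<close> times
      \<open>g\<close>.\<close>
    let ?u = "(s / h_X $ i) \<cdot>\<^sub>v u"
    have y: "?y \<in> configs N" using x AN by (auto simp: configs_iff)
    have yz: "?y z = x z + s * g z" if "z \<in> N" for z using off(1)[of z] that by simp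
    have "?y (Q j) = x (Q j) + (H_X\<^sup>T *\<^sub>v ?u) $ j" if "j < n" for j
      using yz[of "Q j"] that by (simp add: N_def reg_Q_def g_def mult[OF dims(1) u(1)] u(2))
    moreover have "?y (B j) = x (B j) + (F_X\<^sup>T *\<^sub>v ?u) $ j" if "j < c" for j
      using yz[of "B j"] that by (simp add: N_def reg_B_def g_def mult[OF dims(3) u(1)])
    ultimately have "\<psi> ?y = trace_char ((\<Sum>j<n. (H_Z\<^sup>T *\<^sub>v 0\<^sub>v r_Z) $ j * x (Q j))
        + (\<Sum>j<c. (F_Z\<^sup>T *\<^sub>v 0\<^sub>v r_Z) $ j * x (B j))) * \<psi> x"
      using x y u(1) unfolding N_def
      by (intro ea_css_code_shift[OF dims \<psi>, of ?u]) auto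
    then show ?thesis by (simp add: zero[OF dims(2)] zero[OF dims(4)])
  qed
  obtain Rec where "quantum_channel (configs A) Rec"
    and "\<forall>\<psi>\<in>?\<C>. channel_tensor_id A Rec (N - A) (erasure N (Q i) (ketbra \<psi>)) = ketbra \<psi>"
    by (rule recovery_channel[where g = g and l = l, OF finN AN iA gi li lg kets supp inv])
  moreover have "?R \<subseteq> {..<n} - {i}" using supp_n by auto
  ultimately show ?thesis
    unfolding recovery_set_def W[symmetric] A_def[symmetric] N_def[symmetric] by blast
qed

theorem theorem3:
  fixes C_X C_Z :: "'a::finite_field vec set"
    and H_X H_Z F_X F_Z :: "'a mat"
    and n k_X k_Z c :: nat
    and d_X d_Z :: enat
  assumes "n \<ge> 1"
    and "linear_code n k_X d_X C_X"
    and "linear_code n k_Z d_Z C_Z"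
    and "d_X \<ge> 2"
    and "d_Z \<ge> 2"
    and "parity_check_matrix n C_X H_X"
    and "parity_check_matrix n C_Z H_Z"
    and "c = vec_space.rank (n - k_X) (H_X * H_Z\<^sup>T)"
    and "rank_factorization (- (H_X * H_Z\<^sup>T)) c F_X F_Z"
    and "css_like_EAQLRC n C_X C_Z"
  shows "(\<exists>r. has_locality n c (ea_css_code H_X H_Z F_X F_Z) r) \<and>
         int (min_locality n c (ea_css_code H_X H_Z F_X F_Z))
           \<le> min (int n - 1) (int k_X + int k_Z - int (code_dim n (C_X \<inter> C_Z)))"
proof -
  let ?\<C> = "ea_css_code H_X H_Z F_X F_Z" and ?d = "code_dim n (C_X \<inter> C_Z)"
  \<comment> \<open>Both subtractions are on naturals; they agree with the integer bound since
    \<open>n \<ge> 1\<close> and \<open>?d \<le> k_X + k_Z\<close>.\<close>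
  define r where "r = min (n - 1) (k_X + k_Z - ?d)"
  have dims: "H_X \<in> carrier_mat (n - code_dim n C_X) n" "H_Z \<in> carrier_mat (n - code_dim n C_Z) n"
    and dual: "dual_code n C_X = vec_space.row_space n H_X" "dual_code n C_Z = vec_space.row_space n H_Z"
    using assms(6,7) by (auto simp: parity_check_matrix_def)
  have F: "F_X \<in> carrier_mat (n - code_dim n C_X) c" "F_Z \<in> carrier_mat (n - code_dim n C_Z) c"
    and fact: "- (H_X * H_Z\<^sup>T) = F_X * F_Z\<^sup>T"
    using assms(9) dims by (auto simp: rank_factorization_def)
  have check: "\<exists>h_X h_Z. h_X \<in> dual_code n C_X \<and> h_Z \<in> dual_code n C_Z \<and> i \<in> supp h_X \<and> i \<in> supp h_Z \<and>
      card (supp h_X \<union> supp h_Z - {i}) \<le> n - 1 \<and>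
      card (supp h_X \<union> supp h_Z - {i}) + ?d \<le> k_X + k_Z" if "i < n" for i
    using local_check_words[OF assms(2-5) that] by metis
  have "has_locality n c ?\<C> r"
    unfolding has_locality_def
  proof (intro allI impI)
    fix i assume i: "i < n"
    obtain h_X h_Z where h: "h_X \<in> dual_code n C_X" "h_Z \<in> dual_code n C_Z" "i \<in> supp h_X" "i \<in> supp h_Z"
      "card (supp h_X \<union> supp h_Z - {i}) \<le> n - 1"
      "card (supp h_X \<union> supp h_Z - {i}) + ?d \<le> k_X + k_Z"
      using check[OF i] by blast
    have "recovery_set n c ?\<C> i (supp h_X \<union> supp h_Z - {i})"
      using h by (intro recovery_set_of_check_words[OF dims F fact i]) (simp_all add: dual)
    moreover have "card (supp h_X \<union> supp h_Z - {i}) \<le> r" using h(5,6) by (simp add: r_def)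
    ultimately show "\<exists>R. recovery_set n c ?\<C> i R \<and> card R \<le> r" by blast
  qed
  moreover from this have "min_locality n c ?\<C> \<le> r" unfolding min_locality_def by (rule Least_le)
  \<comment> \<open>Read off from the additive bound at coordinate 0, which exists because
    \<open>n \<ge> 1\<close>.\<close>
  moreover have "?d \<le> k_X + k_Z" using check[of 0] assms(1) by auto
  ultimately show ?thesis using assms(1) by (auto simp: r_def)
qed

end
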